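(* Let $V\ge 2$, let $s$ be a probability distribution on $\{1,\dots,V\}$ with $s(V)>0$, and let $C$ be a buffer capacity. Let $M^{\mathrm{LPR}}[s]$ and $M^{\mathrm{OPT}}[s]$ denote the expected miss rates of the LPR policy and of the OPT policy with a buffer of capacity $C$ under the LRU stack model with stack-depth distribution $s$, and let $\chi[s]=M^{\mathrm{LPR}}[s]/M^{\mathrm{OPT}}[s]$. Then $\chi[s]=O(\ln C)$. Moreover, if $M^{\mathrm{LPR}}[s]\ge 1/C$, then $\chi[s]=O\!\left(\ln \frac{1}{M^{\mathrm{LPR}}[s]}\right)$. The constants hidden in the $O(\cdot)$ are absolute (independent of $s$, $C$ and $V$).
   Context: LRU stack model (LRUSM): there are $V$ items. At each time $t$ the LRU stack $\Lambda_t$ lists all items in order of most recent access ($\Lambda_t(1)$ is the most recently accessed). The next access is $a_{t+1}=\Lambda_t(d_t)$, where the stack depths $d_0,d_1,\dots$ are i.i.d. with $\Pr[d_t=j]=s(j)$; then $\Lambda_{t+1}$ is obtained by moving $\Lambda_t(d_t)$ to the top and shifting the items in positions $1,\dots,d_t-1$ down by one. An initial stack $\Lambda_0$ is given. Write $S(j)=\sum_{i\le j}s(i)$ and $\bar s(i,j)=\frac{1}{j-i+1}\sum_{k=i}^{j}s(k)$. A buffer of capacity $C$ holds at most $C$ items; an access to an item not in the buffer is a miss, the item is brought in, and if the buffer was full an eviction policy chooses an item in the buffer (other than the one just accessed) to evict. The miss rate of a policy is $\lim_{\tau\to\infty}\frac1\tau\,\mathbb E[\text{number of misses among the first }\tau\text{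 accesses}]$. The profit rate of the item at LRU depth $i\ge 2$ is $\xi(i)=\max_{i\le j\le V}\bar s(i,j)$. The Least Profit Rate (LPR) policy, upon a miss with full buffer, evicts the buffered item whose current LRU depth $i$ minimizes $\xi(i)$, ties broken in favor of the item closest to the top of the LRU stack. OPT is the off-line policy that, upon a miss with full buffer, evicts a buffered item that will never be accessed again if one exists, and otherwise the buffered item whose next access is furthest in the future. *)

theory Defs
  imports "HOL-Probability.Probability"
begin

text \<open>
  Items are natural numbers. A stack is a function \<open>\<Lambda>\<close> whose value \<open>\<Lambda> j\<close> at \<open>j \<in> {1..V}\<close> is the
  item at depth \<open>j\<close>; its values outside \<open>{1..V}\<close> are irrelevant. A trace is given by the initial
  stack \<open>\<Lambda>0\<close> and the sequence \<open>d\<close> of stack depths.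
\<close>

definition move_to_top :: "(nat \<Rightarrow> nat) \<Rightarrow> nat \<Rightarrow> nat \<Rightarrow> nat" where
  "move_to_top \<Lambda> k j = (if j = 1 then \<Lambda> k else if j \<le> k then \<Lambda> (j - 1) else \<Lambda> j)"

primrec lru_stack :: "(nat \<Rightarrow> nat) \<Rightarrow> (nat \<Rightarrow> nat) \<Rightarrow> nat \<Rightarrow> nat \<Rightarrow> nat" where
  "lru_stack \<Lambda>0 d 0 = \<Lambda>0"
| "lru_stack \<Lambda>0 d (Suc t) = move_to_top (lru_stack \<Lambda>0 d t) (d t)"

text \<open>\<open>accessed \<Lambda>0 d t\<close> is the item \<open>a\<^sub>t\<^sub>+\<^sub>1 = \<Lambda>\<^sub>t(d\<^sub>t)\<close>, so the first access has index 0.\<close>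

definition accessed :: "(nat \<Rightarrow> nat) \<Rightarrow> (nat \<Rightarrow> nat) \<Rightarrow> nat \<Rightarrow> nat" where
  "accessed \<Lambda>0 d t = lru_stack \<Lambda>0 d t (d t)"

text \<open>
  \<open>P d t B\<close> is the item that the policy \<open>P\<close> evicts from the full buffer \<open>B\<close> when
  \<open>accessed \<Lambda>0 d t\<close> misses. As \<open>P\<close> receives all of \<open>d\<close>, it may be off-line. The argument \<open>B\<close> is
  the content before the missing item is brought in, so that item is never a candidate.
\<close>

type_synonym policy = "(nat \<Rightarrow> nat) \<Rightarrow> nat \<Rightarrow> nat set \<Rightarrow> nat"

primrec buffer :: "nat \<Rightarrow> (nat \<Rightarrow> nat) \<Rightarrow> policy \<Rightarrow> (nat \<Rightarrow> nat) \<Rightarrow> nat \<Rightarrow> nat set" where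
  "buffer C \<Lambda>0 P d 0 = {}"
| "buffer C \<Lambda>0 P d (Suc t) =
    (let B = buffer C \<Lambda>0 P d t; x = accessed \<Lambda>0 d t in
      if x \<in> B then B
      else if card B < C then insert x B
      else insert x (B - {P d t B}))"

definition misses :: "nat \<Rightarrow> (nat \<Rightarrow> nat) \<Rightarrow> policy \<Rightarrow> (nat \<Rightarrow> nat) \<Rightarrow> nat \<Rightarrow> nat" where
  "misses C \<Lambda>0 P d \<tau> = card {t. t < \<tau> \<and> accessed \<Lambda>0 d t \<notin> buffer C \<Lambda>0 P d t}"

definition depth_space :: "nat pmf \<Rightarrow> (nat \<Rightarrow> nat) measure" where
  "depth_space s = Pi\<^sub>M UNIV (\<lambda>_. measure_pmf s)"

definition miss_rate :: "nat pmf \<Rightarrow> nat \<Rightarrow> (nat \<Rightarrow> nat) \<Rightarrow> policy \<Rightarrow> real" where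
  "miss_rate s C \<Lambda>0 P =
    lim (\<lambda>\<tau>. (\<integral>d. real (misses C \<Lambda>0 P d \<tau>) \<partial>depth_space s) / real \<tau>)"

definition avg_prob :: "nat pmf \<Rightarrow> nat \<Rightarrow> nat \<Rightarrow> real" where
  "avg_prob s i j = (\<Sum>k=i..j. pmf s k) / (real j - real i + 1)"

definition profit_rate :: "nat \<Rightarrow> nat pmf \<Rightarrow> nat \<Rightarrow> real" where
  "profit_rate V s i = Max (avg_prob s i ` {i..V})"

text \<open>
  The current stack is the one after the missing item has moved to the top, hence \<open>Suc t\<close>; the
  items of \<open>B\<close> then have depth at least 2. The least depth among the minimizers is the one
  closest to the top.
\<close>

definition lpr :: "nat \<Rightarrow> nat pmf \<Rightarrow> (nat \<Rightarrow> nat) \<Rightarrow> policy" where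
  "lpr V s \<Lambda>0 d t B =
    (let \<Lambda> = lru_stack \<Lambda>0 d (Suc t); D = {i \<in> {2..V}. \<Lambda> i \<in> B} in
      \<Lambda> (LEAST i. i \<in> D \<and> (\<forall>j\<in>D. profit_rate V s i \<le> profit_rate V s j)))"

definition never_again :: "(nat \<Rightarrow> nat) \<Rightarrow> (nat \<Rightarrow> nat) \<Rightarrow> nat \<Rightarrow> nat \<Rightarrow> bool" where
  "never_again \<Lambda>0 d t y \<longleftrightarrow> (\<forall>u>t. accessed \<Lambda>0 d u \<noteq> y)"

definition next_access :: "(nat \<Rightarrow> nat) \<Rightarrow> (nat \<Rightarrow> nat) \<Rightarrow> nat \<Rightarrow> nat \<Rightarrow> nat" where
  "next_access \<Lambda>0 d t y = (LEAST u. t < u \<and> accessed \<Lambda>0 d u = y)"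

text \<open>
  The choice among several items that are never accessed again is left open. If there is no such
  item, next access times of distinct items differ, so the maximizer is unique.
\<close>

definition opt :: "(nat \<Rightarrow> nat) \<Rightarrow> policy" where
  "opt \<Lambda>0 d t B =
    (if \<exists>y\<in>B. never_again \<Lambda>0 d t y then (SOME y. y \<in> B \<and> never_again \<Lambda>0 d t y)
     else (ARG_MAX (next_access \<Lambda>0 d t) y. y \<in> B))"

definition M_LPR :: "nat \<Rightarrow> nat pmf \<Rightarrow> nat \<Rightarrow> (nat \<Rightarrow> nat) \<Rightarrow> real" where
  "M_LPR V s C \<Lambda>0 = miss_rate s C \<Lambda>0 (lpr V s \<Lambda>0)"

definition M_OPT :: "nat pmf \<Rightarrow> nat \<Rightarrow> (nat \<Rightarrow> nat) \<Rightarrow> real" where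
  "M_OPT s C \<Lambda>0 = miss_rate s C \<Lambda>0 (opt \<Lambda>0)"

text \<open>
  If \<open>V \<le> C\<close>, both miss rates are 0 and the ratio has the value 0 by the convention \<open>x / 0 = 0\<close>.
\<close>

definition chi :: "nat \<Rightarrow> nat pmf \<Rightarrow> nat \<Rightarrow> (nat \<Rightarrow> nat) \<Rightarrow> real" where
  "chi V s C \<Lambda>0 = M_LPR V s C \<Lambda>0 / M_OPT s C \<Lambda>0"

end

theory Submission
  imports Defs "HOL-Library.Landau_Symbols"
begin

text \<open>
  On LPR: if the edge over the capacity \<open>C\<close> of the least concave majorant of the distribution
  function \<open>S\<close> joins the depths \<open>K \<le> C < L\<close>, then a full LPR buffer contains the depths \<open>1..K\<close>
  and nothing below \<open>L\<close>, and every miss evicts depth \<open>L + 1\<close> or \<open>K + 1\<close>. The set of occupied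
  depths in \<open>K + 1..L\<close> is rotated by each access, so in the long run these depths are equally
  likely to be occupied, and the miss rate is \<open>M = 1 - S(K) - \<beta> (C - K)\<close>, where \<open>\<beta>\<close> is the slope
  of the edge.

  On OPT: the misses in any window of \<open>T\<close> accesses number at least the distinct items accessed
  minus \<open>C\<close>. The number of distinct items grows from \<open>k\<close> to \<open>k + 1\<close> with probability
  \<open>1 - S(k)\<close>, which is at least \<open>M - \<beta> (k - C)\<close> by concavity. As this bound is affine in \<open>k\<close>, it
  can be iterated in expectation. With \<open>R = 2 (\<beta> (C - 1) + M) / M\<close> and \<open>T\<close> about \<open>ln R / \<beta>\<close> the
  miss rate of OPT is at least of order \<open>M / ln R\<close>. Finally \<open>\<beta> \<le> M\<close> gives \<open>R \<le> 2 C\<close>, and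
  \<open>M + \<beta> (C - 1) \<le> 1\<close> gives \<open>R \<le> 2 / M\<close>.
\<close>

section \<open>Optimality of OPT\<close>

definition faults :: "(nat \<Rightarrow> nat) \<Rightarrow> (nat \<Rightarrow> nat set) \<Rightarrow> nat \<Rightarrow> nat" where
  "faults x B n = card {t. t < n \<and> x t \<notin> B t}"

lemma faults_0 [simp]: "faults x B 0 = 0"
  by (simp add: faults_def)

lemma faults_Suc: "faults x B (Suc n) = faults x B n + of_bool (x n \<notin> B n)"
proof -
  have "{t. t < Suc n \<and> x t \<notin> B t} =
      (if x n \<in> B n then {t. t < n \<and> x t \<notin> B t} else insert n {t. t < n \<and> x t \<notin> B t})"
    by (auto simp: less_Suc_eq)
  then show ?thesis by (simp add: faults_def)
qed

lemma misses_eq_faults: "misses C \<Lambda>0 P d n = faults (accessed \<Lambda>0 d) (buffer C \<Lambda>0 P d) n"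
  by (simp add: misses_def faults_def)

lemma faults_le: "faults x B n \<le> n"
  by (induction n) (auto simp: faults_Suc)

lemma faults_cong:
  "(\<And>t. t < n \<Longrightarrow> x t \<notin> B t \<longleftrightarrow> x' t \<notin> B' t) \<Longrightarrow> faults x B n = faults x' B' n"
  unfolding faults_def by (rule arg_cong[where f = card]) auto

text \<open>Competitors of OPT are sequences of buffers, not policies. A step may drop any number of
  items, even on a hit; this admits competitors that flush or relabel their buffer.\<close>

definition demand_paging :: "nat \<Rightarrow> (nat \<Rightarrow> nat) \<Rightarrow> nat \<Rightarrow> (nat \<Rightarrow> nat set) \<Rightarrow> bool" where
  "demand_paging C x n B \<longleftrightarrow> B 0 = {} \<and> (\<forall>t\<le>n. finite (B t) \<and> card (B t) \<le> C) \<and>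
     (\<forall>t<n. x t \<in> B (Suc t) \<and> B (Suc t) \<subseteq> insert (x t) (B t))"

lemma opt_in:
  assumes "finite B" "B \<noteq> {}"
  shows "opt \<Lambda>0 d t B \<in> B"
proof (cases "\<exists>y\<in>B. never_again \<Lambda>0 d t y")
  case True
  then have "\<exists>y. y \<in> B \<and> never_again \<Lambda>0 d t y" by blast
  from someI_ex[OF this] True show ?thesis unfolding opt_def by simp
next
  case False
  have "(ARG_MAX (next_access \<Lambda>0 d t) y. y \<in> B) \<in> B"
  proof -
    obtain z where z: "z \<in> B" using assms by blast
    have "\<forall>y. y \<in> B \<longrightarrow> next_access \<Lambda>0 d t y < Suc (Max (next_access \<Lambda>0 d t ` B))"
      using assms by (simp add: le_imp_less_Suc)
    from arg_max_natI[OF z this] show ?thesis .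
  qed
  with False show ?thesis unfolding opt_def by simp
qed

text \<open>OPT picks a victim that recurs only if every buffered item recurs, and then the victim
  is the last of them to do so.\<close>

lemma opt_furthest:
  assumes fin: "finite B" and ne: "B \<noteq> {}"
    and e: "opt \<Lambda>0 d t B \<in> accessed \<Lambda>0 d ` {Suc t..u}"
  shows "B \<subseteq> accessed \<Lambda>0 d ` {Suc t..u}"
proof -
  let ?e = "opt \<Lambda>0 d t B"
  let ?n = "next_access \<Lambda>0 d t"
  from e obtain v where v: "t < v" "v \<le> u" "accessed \<Lambda>0 d v = ?e"
    by (metis Suc_le_lessD atLeastAtMost_iff imageE)
  have none: "\<not> (\<exists>y\<in>B. never_again \<Lambda>0 d t y)"
  proof
    assume ex: "\<exists>y\<in>B. never_again \<Lambda>0 d t y"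
    then have "\<exists>y. y \<in> B \<and> never_again \<Lambda>0 d t y" by blast
    from someI_ex[OF this] ex have "never_again \<Lambda>0 d t ?e" unfolding opt_def by simp
    with v show False by (simp add: never_again_def)
  qed
  then have e_eq: "?e = (ARG_MAX ?n y. y \<in> B)" unfolding opt_def by simp
  have ne_u: "?n ?e \<le> u"
    unfolding next_access_def by (rule order_trans[OF Least_le v(2)]) (use v in auto)
  show ?thesis
  proof
    fix y assume y: "y \<in> B"
    have "\<forall>z. z \<in> B \<longrightarrow> ?n z < Suc (Max (?n ` B))"
      using assms by (simp add: le_imp_less_Suc)
    from arg_max_nat_le[of "\<lambda>y. y \<in> B", OF y this] have le: "?n y \<le> ?n ?e" by (simp add: e_eq)
    from none y obtain w where "t < w" "accessed \<Lambda>0 d w = y" by (auto simp: never_again_def)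
    then have "t < ?n y \<and> accessed \<Lambda>0 d (?n y) = y"
      unfolding next_access_def by (intro LeastI[of "\<lambda>u. t < u \<and> accessed \<Lambda>0 d u = y" w]) auto
    with le ne_u show "y \<in> accessed \<Lambda>0 d ` {Suc t..u}"
      by (intro image_eqI[of _ _ "?n y"]) auto
  qed
qed

lemma buffer_opt_step:
  fixes \<Lambda>0 d C t
  defines "x \<equiv> accessed \<Lambda>0 d" and "B \<equiv> buffer C \<Lambda>0 (opt \<Lambda>0) d"
  shows "B (Suc t) = (if x t \<in> B t then B t else if card (B t) < C then insert (x t) (B t)
      else insert (x t) (B t - {opt \<Lambda>0 d t (B t)}))"
  by (simp add: x_def B_def Let_def)

lemma buffer_finite: "finite (buffer C \<Lambda>0 P d t)"
  by (induction t) (auto simp: Let_def)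

lemma demand_paging_opt:
  assumes "C \<ge> 1"
  shows "demand_paging C (accessed \<Lambda>0 d) n (buffer C \<Lambda>0 (opt \<Lambda>0) d)"
proof -
  define B where "B = buffer C \<Lambda>0 (opt \<Lambda>0) d"
  have fin: "finite (B t)" for t by (simp add: B_def buffer_finite)
  have card: "card (B t) \<le> C" for t
  proof (induction t)
    case (Suc t)
    show ?case
    proof (cases "accessed \<Lambda>0 d t \<notin> B t \<and> \<not> card (B t) < C")
      case True
      then have "card (B t) = C" "B t \<noteq> {}" using Suc assms by auto
      then have "card (B t - {opt \<Lambda>0 d t (B t)}) = C - 1"
        using opt_in[OF fin] fin by simp
      then show ?thesis
        using True assms fin buffer_opt_step[of C \<Lambda>0 d t] by (simp add: B_def card_insert_if)
    next
      case False
      then show ?thesis using Suc fin buffer_opt_step[of C \<Lambda>0 d t]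
        by (auto simp: B_def card_insert_if)
    qed
  qed (simp add: B_def)
  have "accessed \<Lambda>0 d t \<in> B (Suc t) \<and> B (Suc t) \<subseteq> insert (accessed \<Lambda>0 d t) (B t)" for t
    using buffer_opt_step[of C \<Lambda>0 d t] by (auto simp: B_def split: if_splits)
  then show ?thesis using fin card unfolding demand_paging_def B_def by simp
qed

lemma card_Int_insert:
  "finite A \<Longrightarrow> card (A \<inter> insert a W) = card (A \<inter> W) + of_bool (a \<in> A \<and> a \<notin> W)"
  by (cases "a \<in> A") (auto simp: insert_absorb card_insert_if)

text \<open>
  Belady's argument. The clause about \<open>u\<close> compares, for every horizon \<open>u\<close>, how many buffered
  items are accessed again by time \<open>u\<close>: OPT may lag behind only by as many items as it has saved
  in faults.
\<close>

lemma opt_invariant: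
  fixes \<Lambda>0 d C
  defines "x \<equiv> accessed \<Lambda>0 d" and "Q \<equiv> buffer C \<Lambda>0 (opt \<Lambda>0) d"
  assumes C: "C \<ge> 1" and P: "demand_paging C x n P" and t: "t \<le> n"
  shows "faults x Q t \<le> faults x P t \<and>
    (\<forall>u\<ge>t. card (P t \<inter> x ` {t..u}) + faults x Q t \<le> card (Q t \<inter> x ` {t..u}) + faults x P t)"
  using t
proof (induction t)
  case 0
  show ?case using P by (simp add: demand_paging_def Q_def)
next
  case (Suc t)
  then have tn: "t < n" by simp
  define a where "a = x t"
  have IH1: "faults x Q t \<le> faults x P t"
    and IH2: "\<And>u. u \<ge> t \<Longrightarrow> card (P t \<inter> x ` {t..u}) + faults x Q t \<le> card (Q t \<inter> x ` {t..u}) + faults x P t"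
    using Suc by auto
  have Q: "demand_paging C x n Q" unfolding x_def Q_def by (rule demand_paging_opt[OF C])
  have finP: "finite (P t)" "finite (P (Suc t))" and cardP: "card (P (Suc t)) \<le> C"
    and P': "a \<in> P (Suc t)" "P (Suc t) \<subseteq> insert a (P t)"
    using P tn by (auto simp: demand_paging_def a_def)
  have finO: "finite (Q t)" "finite (Q (Suc t))" and cardO: "card (Q t) \<le> C" "card (Q (Suc t)) \<le> C"
    using Q tn by (auto simp: demand_paging_def a_def)
  have Ostep: "Q (Suc t) = (if a \<in> Q t then Q t else if card (Q t) < C then insert a (Q t)
      else insert a (Q t - {opt \<Lambda>0 d t (Q t)}))"
    unfolding a_def x_def Q_def by (rule buffer_opt_step)
  \<comment> \<open>The horizon \<open>u = t\<close> shrinks the window to the current access: a hit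
    of the competitor that OPT misses must be paid for by a fault saved earlier.\<close>
  have now: "card (P t \<inter> {a}) + faults x Q t \<le> card (Q t \<inter> {a}) + faults x P t"
    using IH2[of t] by (simp add: a_def)
  have now': "of_bool (a \<in> P t) + faults x Q t \<le> of_bool (a \<in> Q t) + faults x P t"
    using now by (cases "a \<in> P t"; cases "a \<in> Q t") (auto simp: of_bool_def)
  have le: "faults x Q (Suc t) \<le> faults x P (Suc t)"
    using now' IH1 by (simp add: faults_Suc a_def[symmetric] of_bool_def split: if_splits)
  have "card (P (Suc t) \<inter> x ` {Suc t..u}) + faults x Q (Suc t)
      \<le> card (Q (Suc t) \<inter> x ` {Suc t..u}) + faults x P (Suc t)" if u: "u \<ge> Suc t" for u
  proof -
    define W where "W = x ` {Suc t..u}"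
    have W: "x ` {t..u} = insert a W"
    proof -
      have "{t..u} = insert t {Suc t..u}" using u by auto
      then show ?thesis by (simp add: W_def a_def)
    qed
    have IH: "card (P t \<inter> W) + of_bool (a \<in> P t \<and> a \<notin> W) + faults x Q t
        \<le> card (Q t \<inter> W) + of_bool (a \<in> Q t \<and> a \<notin> W) + faults x P t"
      using IH2[of u] u by (simp add: W card_Int_insert finP finO)
    have cP: "card (P (Suc t) \<inter> W) \<le> card (P t \<inter> W) + of_bool (a \<notin> P t \<and> a \<in> W)"
    proof -
      have "card (P (Suc t) \<inter> W) \<le> card (insert a (P t) \<inter> W)"
        using P'(2) finP by (intro card_mono) auto
      also have "\<dots> \<le> card (P t \<inter> W) + of_bool (a \<notin> P t \<and> a \<in> W)"
        using finP by (cases "a \<in> W"; cases "a \<in> P t") (auto simp: insert_absorb card_insert_if)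
      finally show ?thesis .
    qed
    \<comment> \<open>The item just accessed occupies a slot of the competitor, and this slot is
      lost for \<open>W\<close> if the item lies outside \<open>W\<close>.\<close>
    have cardP2: "card (P (Suc t) \<inter> W) + of_bool (a \<notin> W) \<le> C"
    proof (cases "a \<in> W")
      case True
      then show ?thesis using cardP finP card_mono[of "P (Suc t)" "P (Suc t) \<inter> W"] by simp
    next
      case False
      then have "card (P (Suc t) \<inter> W) \<le> card (P (Suc t) - {a})"
        using finP by (intro card_mono) auto
      also have "\<dots> = card (P (Suc t)) - 1" using P' finP by simp
      finally show ?thesis using cardP C False by simp
    qed
    show ?thesis
    proof (cases "a \<notin> Q t \<and> \<not> card (Q t) < C \<and> opt \<Lambda>0 d t (Q t) \<in> W")
      \<comment> \<open>The critical case: the victim is accessed again by \<open>u\<close>. Then so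
        is the whole full buffer of OPT, whose count is therefore the largest that the capacity
        allows.\<close>
      case True
      then have cC: "card (Q t) = C" and ne: "Q t \<noteq> {}" using cardO C by auto
      have sub: "Q t \<subseteq> W"
        using opt_furthest[OF finO(1) ne] True by (simp add: W_def x_def)
      have "card (Q (Suc t) \<inter> W) + of_bool (a \<notin> W) = C"
      proof -
        have Oeq: "Q (Suc t) = insert a (Q t - {opt \<Lambda>0 d t (Q t)})" using True Ostep by simp
        have c1: "card (Q t - {opt \<Lambda>0 d t (Q t)}) = C - 1"
          using opt_in[OF finO(1) ne] finO cC by simp
        have "Q (Suc t) \<inter> W = (if a \<in> W then insert a (Q t - {opt \<Lambda>0 d t (Q t)})
            else Q t - {opt \<Lambda>0 d t (Q t)})"
          using sub Oeq by auto
        then show ?thesis using c1 True finO C by (simp add: card_insert_if)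
      qed
      with cardP2 le show ?thesis by (simp add: W_def)
    next
      case False
      \<comment> \<open>Here any victim lies outside \<open>W\<close>, so an eviction does not lower
        the count.\<close>
      have "card (Q (Suc t) \<inter> W) = card (Q t \<inter> W) + of_bool (a \<notin> Q t \<and> a \<in> W)"
      proof -
        have "Q (Suc t) \<inter> W = (if a \<in> W then insert a (Q t \<inter> W) else Q t \<inter> W)"
          using False Ostep by (auto split: if_splits)
        then show ?thesis using finO by (auto simp: insert_absorb card_insert_if)
      qed
      with cP IH show ?thesis
        by (cases "a \<in> P t"; cases "a \<in> Q t"; cases "a \<in> W")
          (simp_all add: faults_Suc W_def[symmetric] a_def[symmetric])
    qed
  qed
  with le show ?case by blast
qed

theorem opt_optimal:
  assumes "C \<ge> 1" "demand_paging C (accessed \<Lambda>0 d) n P"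
  shows "misses C \<Lambda>0 (opt \<Lambda>0) d n \<le> faults (accessed \<Lambda>0 d) P n"
  using opt_invariant[OF assms order_refl] by (simp add: misses_eq_faults)

text \<open>The image of the buffers of OPT under a relabelling is a competitor of OPT on the relabelled trace.\<close>

lemma misses_opt_relabel_le:
  assumes C: "C \<ge> 1" and f: "\<And>t. t < n \<Longrightarrow> accessed \<Lambda>' d' t = f (accessed \<Lambda> d t)"
    and inj: "inj_on f (accessed \<Lambda> d ` {..<n})"
  shows "misses C \<Lambda>' (opt \<Lambda>') d' n \<le> misses C \<Lambda> (opt \<Lambda>) d n"
proof -
  let ?x = "accessed \<Lambda> d" and ?y = "accessed \<Lambda>' d'"
  let ?B = "buffer C \<Lambda> (opt \<Lambda>) d"
  have Q: "demand_paging C ?x n ?B" by (rule demand_paging_opt[OF C])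
  \<comment> \<open>Only items accessed before are buffered, so injectivity of \<open>f\<close> on
    the accessed items is enough to carry hits and misses over.\<close>
  have sub: "?B t \<subseteq> ?x ` {..<t}" if "t \<le> n" for t
    using that
  proof (induction t)
    case (Suc t)
    then have "?B (Suc t) \<subseteq> insert (?x t) (?B t)" using Q by (simp add: demand_paging_def del: buffer.simps)
    with Suc show ?case by (force simp: lessThan_Suc simp del: buffer.simps)
  qed simp
  have D: "demand_paging C ?y n (\<lambda>t. f ` ?B t)"
    unfolding demand_paging_def
  proof (intro conjI allI impI)
    fix t assume "t < n"
    with Q have "?x t \<in> ?B (Suc t)" "?B (Suc t) \<subseteq> insert (?x t) (?B t)"
      by (auto simp: demand_paging_def simp del: buffer.simps)
    with f[OF \<open>t < n\<close>] show "?y t \<in> f ` ?B (Suc t)" "f ` ?B (Suc t) \<subseteq> insert (?y t) (f ` ?B t)"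
      by (auto simp del: buffer.simps)
  qed (use Q in \<open>auto simp: demand_paging_def intro: order_trans[OF card_image_le]\<close>)
  have "faults ?y (\<lambda>t. f ` ?B t) n = faults ?x ?B n"
  proof (rule faults_cong)
    fix t assume t: "t < n"
    have "?x t \<in> ?x ` {..<n}" "?B t \<subseteq> ?x ` {..<n}" using sub[of t] t by auto
    then show "(?y t \<notin> f ` ?B t) = (?x t \<notin> ?B t)"
      using inj f[OF t] by (auto simp: inj_on_image_mem_iff)
  qed
  with opt_optimal[OF C D] show ?thesis by (simp add: misses_eq_faults)
qed

text \<open>Apply the inequality to \<open>f\<close> and to its inverse on the accessed
  items.\<close>

lemma misses_opt_relabel:
  assumes C: "C \<ge> 1" and f: "\<And>t. t < n \<Longrightarrow> accessed \<Lambda>' d' t = f (accessed \<Lambda> d t)"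
    and inj: "inj_on f (accessed \<Lambda> d ` {..<n})"
  shows "misses C \<Lambda>' (opt \<Lambda>') d' n = misses C \<Lambda> (opt \<Lambda>) d n"
proof (rule antisym)
  let ?A = "accessed \<Lambda> d ` {..<n}"
  show "misses C \<Lambda> (opt \<Lambda>) d n \<le> misses C \<Lambda>' (opt \<Lambda>') d' n"
  proof (rule misses_opt_relabel_le[OF C, where f = "the_inv_into ?A f"])
    show "accessed \<Lambda> d t = the_inv_into ?A f (accessed \<Lambda>' d' t)" if "t < n" for t
      using f[OF that] that inj by (simp add: the_inv_into_f_f)
    have "accessed \<Lambda>' d' ` {..<n} = f ` ?A" using f by (auto simp: image_iff)
    then show "inj_on (the_inv_into ?A f) (accessed \<Lambda>' d' ` {..<n})"
      using inj_on_the_inv_into[OF inj] by simp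
  qed
qed (rule misses_opt_relabel_le[OF assms])

section \<open>Stacks and distinct accesses\<close>

text \<open>Fekete's lemma, which yields existence of the limit in the miss rate of OPT. Pick
  \<open>m\<close> with ratio close to the infimum and divide \<open>n\<close> by \<open>m\<close>
  with remainder.\<close>

lemma fekete_nonneg:
  fixes f :: "nat \<Rightarrow> real"
  assumes sub: "\<And>m n. f (m + n) \<le> f m + f n" and nonneg: "\<And>n. 0 \<le> f n"
  shows "\<exists>L. (\<lambda>n. f n / real n) \<longlonglongrightarrow> L"
proof -
  define L where "L = (INF n\<in>{1..}. f n / real n)"
  have bdd: "bdd_below ((\<lambda>n. f n / real n) ` {1..})"
    using nonneg by (intro bdd_belowI[of _ 0]) auto
  have lower: "L \<le> f n / real n" if "n \<ge> 1" for n
    unfolding L_def by (rule cINF_lower[OF bdd]) (use that in auto)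
  have mult: "f (q * m) \<le> real q * f m + f 0" for q m
  proof (induction q)
    case (Suc q)
    have "f (Suc q * m) \<le> f m + f (q * m)" using sub[of m "q * m"] by simp
    with Suc show ?case by (simp add: algebra_simps)
  qed simp
  have "(\<lambda>n. f n / real n) \<longlonglongrightarrow> L"
  proof (rule LIMSEQ_I)
    fix e :: real assume e: "e > 0"
    have "\<exists>m\<in>{1..}. f m / real m < L + e / 2"
      using e cINF_less_iff[OF _ bdd, of "L + e / 2"] unfolding L_def by auto
    then obtain m where m: "m \<ge> 1" "f m / real m < L + e / 2" by auto
    \<comment> \<open>\<open>K\<close> bounds the leftover uniformly in \<open>n\<close>:
      \<open>f (n mod m)\<close> is one of the summands, and \<open>f 0\<close> comes from
      \<open>mult\<close>.\<close>
    define K where "K = f 0 + (\<Sum>r<m. f r)"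
    have K0: "K \<ge> 0" unfolding K_def using nonneg by (intro add_nonneg_nonneg sum_nonneg)
    obtain N where N: "real N > 2 * K / e" using reals_Archimedean2 by blast
    have "norm (f n / real n - L) < e" if n: "n \<ge> Suc N" for n
    proof -
      have n0: "real n > 0" using n by simp
      have "f n \<le> f ((n div m) * m) + f (n mod m)"
        using sub[of "(n div m) * m" "n mod m"] by simp
      also have "f (n mod m) \<le> (\<Sum>r<m. f r)"
        using m nonneg by (intro member_le_sum) auto
      also have "f ((n div m) * m) \<le> real (n div m) * f m + f 0" by (rule mult)
      finally have "f n \<le> real (n div m) * f m + K" by (simp add: K_def)
      also have "real (n div m) * f m \<le> real n * (f m / real m)"
      proof -
        have "real (n div m) \<le> real n / real m" by (rule of_nat_div_le_of_nat)
        from mult_right_mono[OF this nonneg[of m]] show ?thesis by simp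
      qed
      finally have "f n / real n \<le> f m / real m + K / real n"
        using n0 by (simp add: field_simps)
      moreover have "K / real n < e / 2"
      proof -
        have "2 * K / e < real n" using N n by simp
        then show ?thesis using e n0 by (simp add: field_simps)
      qed
      moreover have "L \<le> f n / real n" using lower[of n] n by simp
      ultimately show ?thesis using m(2) unfolding real_norm_def by linarith
    qed
    then show "\<exists>no. \<forall>n\<ge>no. norm (f n / real n - L) < e" by blast
  qed
  then show ?thesis by blast
qed

section \<open>Shifting, truncating and relabelling traces\<close>

abbreviation (input) shift :: "nat \<Rightarrow> (nat \<Rightarrow> nat) \<Rightarrow> nat \<Rightarrow> nat" where
  "shift m d \<equiv> (\<lambda>n. d (n + m))"

lemma lru_stack_shift: "lru_stack \<Lambda> d (m + t) = lru_stack (lru_stack \<Lambda> d m) (shift m d) t"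
  by (induction t) (simp_all add: add.commute)

lemma accessed_shift: "accessed \<Lambda> d (m + t) = accessed (lru_stack \<Lambda> d m) (shift m d) t"
  by (simp add: accessed_def lru_stack_shift add.commute)

lemma lru_stack_prefix:
  "(\<And>i. i < t \<Longrightarrow> d i = d' i) \<Longrightarrow> lru_stack \<Lambda> d t = lru_stack \<Lambda> d' t"
  by (induction t) auto

lemma accessed_prefix:
  "(\<And>i. i \<le> t \<Longrightarrow> d i = d' i) \<Longrightarrow> accessed \<Lambda> d t = accessed \<Lambda> d' t"
  using lru_stack_prefix[of t d d' \<Lambda>] by (simp add: accessed_def)

text \<open>The depths act on positions only; the initial stack merely attaches labels. Hence a
  change of initial stack amounts to a relabelling of the items.\<close>

lemma lru_stack_natural: "lru_stack \<Lambda> d t j = \<Lambda> (lru_stack (\<lambda>j. j) d t j)"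
  by (induction t arbitrary: j) (simp_all add: move_to_top_def)

lemma accessed_natural: "accessed \<Lambda> d t = \<Lambda> (accessed (\<lambda>j. j) d t)"
  by (simp add: accessed_def lru_stack_natural[of \<Lambda>])

lemma move_to_top_comp: "move_to_top \<Lambda> k = \<Lambda> \<circ> move_to_top (\<lambda>j. j) k"
  by (auto simp: move_to_top_def)

lemma bij_betw_move_to_top:
  assumes "k \<in> {1..V}"
  shows "bij_betw (move_to_top (\<lambda>j. j) k) {1..V} {1..V}"
proof -
  have inj: "inj_on (move_to_top (\<lambda>j. j) k) {1..V}"
    using assms by (auto simp: inj_on_def move_to_top_def split: if_splits)
  have sub: "move_to_top (\<lambda>j. j) k ` {1..V} \<subseteq> {1..V}"
    using assms by (auto simp: move_to_top_def)
  show ?thesis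
    using inj endo_inj_surj[OF _ sub inj] by (simp add: bij_betw_def)
qed

lemma bij_betw_lru_stack:
  assumes "bij_betw \<Lambda> {1..V} R" "\<And>i. i < t \<Longrightarrow> d i \<in> {1..V}"
  shows "bij_betw (lru_stack \<Lambda> d t) {1..V} R"
  using assms(2)
proof (induction t)
  case (Suc t)
  then show ?case
    using bij_betw_trans[OF bij_betw_move_to_top Suc.IH, of "d t"]
    by (simp add: move_to_top_comp[of "lru_stack \<Lambda> d t"] comp_def)
qed (use assms(1) in simp)

text \<open>The number of distinct items among the first accesses, read off the depths alone: these
  items fill the top of the stack, so an access is new exactly when it reaches below them.\<close>

primrec distinct_count :: "(nat \<Rightarrow> nat) \<Rightarrow> nat \<Rightarrow> nat" where
  "distinct_count d 0 = 0"
| "distinct_count d (Suc t) = distinct_count d t + of_bool (d t > distinct_count d t)"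

lemma distinct_count_le: "(\<And>i. i < t \<Longrightarrow> d i \<le> V) \<Longrightarrow> distinct_count d t \<le> V"
proof (induction t)
  case (Suc t)
  have "d t \<le> V" by (rule Suc.prems) simp
  moreover have "distinct_count d t \<le> V" by (rule Suc.IH) (simp add: Suc.prems)
  ultimately show ?case by (auto simp: of_bool_def)
qed simp

lemma accessed_image:
  assumes "bij_betw \<Lambda> {1..V} R" "\<And>i. i < t \<Longrightarrow> d i \<in> {1..V}"
  shows "accessed \<Lambda> d ` {..<t} = lru_stack \<Lambda> d t ` {1..distinct_count d t}"
  using assms(2)
proof (induction t)
  case (Suc t)
  let ?n = "distinct_count d t" and ?L = "lru_stack \<Lambda> d t"
  have d: "d t \<in> {1..V}" using Suc.prems by simp
  have "accessed \<Lambda> d ` {..<Suc t} = insert (?L (d t)) (?L ` {1..?n})"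
    using Suc by (simp add: lessThan_Suc accessed_def)
  also have "\<dots> = lru_stack \<Lambda> d (Suc t) ` {1..distinct_count d (Suc t)}"
  proof (cases "d t > ?n")
    case True
    have "{1..Suc ?n} = insert 1 (Suc ` {1..?n})"
      by (auto simp: image_Suc_atLeastAtMost)
    moreover have "move_to_top ?L (d t) (Suc j) = ?L j" if "j \<in> {1..?n}" for j
      using that True by (auto simp: move_to_top_def)
    moreover have "move_to_top ?L (d t) 1 = ?L (d t)"
      by (simp add: move_to_top_def)
    ultimately have "move_to_top ?L (d t) ` {1..Suc ?n} = insert (?L (d t)) (?L ` {1..?n})"
      by (simp only: image_insert image_image cong: image_cong)
    then show ?thesis using True by simp
  next
    case False
    \<comment> \<open>An access to one of the top \<open>?n\<close> positions only permutes these
      positions.\<close>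
    then have "bij_betw (move_to_top (\<lambda>j. j) (d t)) {1..?n} {1..?n}"
      using d by (intro bij_betw_move_to_top) auto
    then have "?L ` {1..?n} = move_to_top ?L (d t) ` {1..?n}"
      by (subst move_to_top_comp) (metis bij_betw_imp_surj_on image_comp)
    moreover have "insert (?L (d t)) (?L ` {1..?n}) = ?L ` {1..?n}"
      using d False by auto
    ultimately show ?thesis using False by simp
  qed
  finally show ?case .
qed simp

lemma card_accessed:
  assumes "bij_betw \<Lambda> {1..V} R" "\<And>i. i < t \<Longrightarrow> d i \<in> {1..V}"
  shows "card (accessed \<Lambda> d ` {..<t}) = distinct_count d t"
proof -
  have "distinct_count d t \<le> V" using assms(2) by (intro distinct_count_le) auto
  then have "inj_on (lru_stack \<Lambda> d t) {1..distinct_count d t}"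
    using inj_on_subset[OF bij_betw_imp_inj_on[OF bij_betw_lru_stack[OF assms]]]
    by simp
  then show ?thesis by (simp add: accessed_image[OF assms] card_image)
qed

text \<open>The first access in the window to an item not buffered at its beginning is a fault.\<close>

lemma distinct_le_faults:
  assumes "demand_paging C x n B" "m + T \<le> n"
  shows "card (x ` {m..<m + T}) + faults x B m \<le> C + faults x B (m + T)"
proof -
  have "card (x ` {m..<m + T} - B m) + faults x B m \<le> faults x B (m + T) \<and>
      B (m + T) \<subseteq> B m \<union> x ` {m..<m + T}"
    using assms(2)
  proof (induction T)
    case (Suc T)
    let ?A = "x ` {m..<m + T}" and ?a = "x (m + T)"
    have img: "x ` {m..<m + Suc T} = insert ?a ?A"
      by (simp add: atLeastLessThanSuc)
    have IH: "card (?A - B m) + faults x B m \<le> faults x B (m + T)" "B (m + T) \<subseteq> B m \<union> ?A"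
      using Suc by auto
    have "B (Suc (m + T)) \<subseteq> insert ?a (B (m + T))"
      using assms(1) Suc.prems by (simp add: demand_paging_def)
    with IH have sub: "B (m + Suc T) \<subseteq> B m \<union> x ` {m..<m + Suc T}" unfolding img by auto
    have "card (insert ?a ?A - B m) \<le> card (?A - B m) + of_bool (?a \<notin> B (m + T))"
      using IH(2) by (cases "?a \<in> B m \<union> ?A")
        (auto simp: insert_Diff_if insert_absorb card_insert_if)
    with IH(1) sub show ?case unfolding img by (simp add: faults_Suc)
  qed simp
  moreover have "card (x ` {m..<m + T}) \<le> card (x ` {m..<m + T} - B m) + card (B m)"
  proof -
    have "finite (B m)" using assms by (simp add: demand_paging_def)
    then have "card (x ` {m..<m + T}) \<le> card ((x ` {m..<m + T} - B m) \<union> B m)"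
      by (intro card_mono) auto
    also have "\<dots> \<le> card (x ` {m..<m + T} - B m) + card (B m)" by (rule card_Un_le)
    finally show ?thesis .
  qed
  moreover have "card (B m) \<le> C" using assms by (simp add: demand_paging_def)
  ultimately show ?thesis by linarith
qed

section \<open>Misses of OPT as a function of the depths\<close>

text \<open>The buffers of OPT may depend on later depths, but by optimality the number of misses
  cannot: this is relabelling by the identity.\<close>

lemma misses_opt_prefix:
  assumes "C \<ge> 1" "\<And>i. i < n \<Longrightarrow> d i = d' i"
  shows "misses C \<Lambda> (opt \<Lambda>) d n = misses C \<Lambda> (opt \<Lambda>) d' n"
  using assms accessed_prefix[of _ d d' \<Lambda>]
  by (intro misses_opt_relabel[where f = "\<lambda>y. y"]) auto

lemma misses_opt_subadditive:
  assumes C: "C \<ge> 1" and inj: "inj_on \<Lambda> {1..V}" and d: "\<And>i. d i \<in> {1..V}"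
  shows "misses C \<Lambda> (opt \<Lambda>) d (m + n)
    \<le> misses C \<Lambda> (opt \<Lambda>) d m + misses C \<Lambda> (opt \<Lambda>) (shift m d) n"
proof (cases "n = 0")
  case False
  let ?x = "accessed \<Lambda> d" and ?B = "buffer C \<Lambda> (opt \<Lambda>) d"
  let ?M = "lru_stack \<Lambda> d m"
  let ?B' = "buffer C ?M (opt ?M) (shift m d)"
  \<comment> \<open>a competitor that empties its buffer after \<open>m\<close> accesses and then follows OPT on the rest\<close>
  let ?P = "\<lambda>t. if t \<le> m then ?B t else ?B' (t - m)"
  have bij: "bij_betw \<Lambda> {1..V} (\<Lambda> ` {1..V})" using inj by (simp add: bij_betw_def)
  have D: "demand_paging C ?x (m + n) ?P"
    unfolding demand_paging_def
  proof (intro conjI allI impI)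
    fix t
    show "finite (?P t)" by (simp add: buffer_finite)
    show "card (?P t) \<le> C"
      using demand_paging_opt[OF C, of \<Lambda> d t] demand_paging_opt[OF C, of ?M "shift m d" "t - m"]
      by (simp add: demand_paging_def)
  next
    fix t
    have *: "?x t \<in> ?P (Suc t) \<and> ?P (Suc t) \<subseteq> insert (?x t) (?P t)"
    proof (cases "t < m")
      case True
      then show ?thesis using demand_paging_opt[OF C, of \<Lambda> d "Suc t"]
        by (simp add: demand_paging_def del: buffer.simps(2))
    next
      case False
      then obtain k where k: "t = m + k" using le_Suc_ex by (metis not_less)
      have "?x t = accessed ?M (shift m d) k" by (simp add: k accessed_shift)
      moreover have "accessed ?M (shift m d) k \<in> ?B' (Suc k)"
        "?B' (Suc k) \<subseteq> insert (accessed ?M (shift m d) k) (?B' k)"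
        using demand_paging_opt[OF C, of ?M "shift m d" "Suc k"]
        by (simp_all add: demand_paging_def del: buffer.simps(2))
      ultimately show ?thesis using k by (cases "k = 0") (auto simp del: buffer.simps(2))
    qed
    show "?x t \<in> ?P (Suc t)" "?P (Suc t) \<subseteq> insert (?x t) (?P t)" using * by blast+
  qed simp
  have *: "faults ?x ?P (m + k) \<le> faults ?x ?B m + faults (accessed ?M (shift m d)) ?B' k" for k
  proof (induction k)
    case 0
    have "faults ?x ?P m = faults ?x ?B m" by (rule faults_cong) auto
    then show ?case by simp
  next
    case (Suc k)
    have "?x (m + k) = accessed ?M (shift m d) k" by (simp add: accessed_shift)
    \<comment> \<open>At \<open>k = 0\<close> the competitor still holds its old buffer while the
      restarted OPT is empty, which can only add a fault on the right.\<close>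
    with Suc show ?case by (cases "k = 0") (simp_all add: faults_Suc)
  qed
  have "misses C \<Lambda> (opt \<Lambda>) d (m + n) \<le> misses C \<Lambda> (opt \<Lambda>) d m + misses C ?M (opt ?M) (shift m d) n"
    using opt_optimal[OF C D] *[of n] by (simp add: misses_eq_faults)
  \<comment> \<open>After \<open>m\<close> accesses the stack holds the same items in another order,
    so restarting from it is a relabelling of restarting from \<open>\<Lambda>\<close>.\<close>
  also have "misses C ?M (opt ?M) (shift m d) n = misses C \<Lambda> (opt \<Lambda>) (shift m d) n"
  proof (rule misses_opt_relabel[OF C])
    let ?f = "?M \<circ> the_inv_into {1..V} \<Lambda>"
    have acc: "accessed (\<lambda>j. j) (shift m d) t \<in> {1..V}" for t
    proof -
      have "bij_betw (lru_stack (\<lambda>j. j) (shift m d) t) {1..V} {1..V}"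
        by (rule bij_betw_lru_stack) (use d in \<open>auto simp: bij_betw_def\<close>)
      then show ?thesis using d[of "t + m"] by (auto simp: accessed_def bij_betw_def)
    qed
    show "accessed ?M (shift m d) t = ?f (accessed \<Lambda> (shift m d) t)" for t
      using acc[of t] inj
      by (simp add: accessed_natural[of ?M] accessed_natural[of \<Lambda>] the_inv_into_f_f del: atLeastAtMost_iff)
    have "bij_betw ?f (\<Lambda> ` {1..V}) (\<Lambda> ` {1..V})"
      by (rule bij_betw_trans[OF bij_betw_the_inv_into[OF bij] bij_betw_lru_stack[OF bij]]) (use d in auto)
    moreover have "accessed \<Lambda> (shift m d) ` {..<n} \<subseteq> \<Lambda> ` {1..V}"
      using acc by (auto simp: accessed_natural[of \<Lambda>] simp del: atLeastAtMost_iff)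
    ultimately show "inj_on ?f (accessed \<Lambda> (shift m d) ` {..<n})"
      by (meson bij_betw_imp_inj_on inj_on_subset)
  qed
  finally show ?thesis .
qed simp

section \<open>Independent stack depths\<close>

text \<open>Replaces measurability with respect to the first \<open>n\<close> depths; since depths
  are discrete, no further condition is called for.\<close>

definition prefix_determined :: "nat \<Rightarrow> ((nat \<Rightarrow> nat) \<Rightarrow> 'a) \<Rightarrow> bool" where
  "prefix_determined n f \<longleftrightarrow> (\<forall>d d'. (\<forall>i<n. d i = d' i) \<longrightarrow> f d = f d')"

lemma prefix_determinedI:
  "(\<And>d d'. (\<And>i. i < n \<Longrightarrow> d i = d' i) \<Longrightarrow> f d = f d') \<Longrightarrow> prefix_determined n f"
  unfolding prefix_determined_def by blast

lemma prefix_determinedD: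
  "prefix_determined n f \<Longrightarrow> (\<And>i. i < n \<Longrightarrow> d i = d' i) \<Longrightarrow> f d = f d'"
  unfolding prefix_determined_def by blast

lemma prob_space_depth_space: "prob_space (depth_space s)"
  unfolding depth_space_def by (intro prob_space_PiM) (rule measure_pmf.prob_space_axioms)

lemma sequence_space_pmf: "sequence_space (measure_pmf s)"
  by (simp add: sequence_space_def product_prob_space_def product_sigma_finite_def
      product_prob_space_axioms_def measure_pmf.prob_space_axioms
      measure_pmf.sigma_finite_measure_axioms)

lemma measurable_depth: "(\<lambda>d. d n) \<in> measurable (depth_space s) (count_space UNIV)"
proof -
  have "(\<lambda>d. d n) \<in> measurable (depth_space s) (measure_pmf s)"
    unfolding depth_space_def by (rule measurable_component_singleton) simp
  then show ?thesis by (simp add: measurable_cong_sets[OF refl sets_measure_pmf_count_space])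
qed

lemma space_depth_space [simp]: "space (depth_space s) = UNIV"
  by (simp add: depth_space_def space_PiM)

text \<open>Fix the value of the last relevant depth, of which there are countably many, and induct
  on their number.\<close>

lemma prefix_measurable:
  fixes f :: "(nat \<Rightarrow> nat) \<Rightarrow> real"
  assumes "prefix_determined n f"
  shows "f \<in> borel_measurable (depth_space s)"
  using assms
proof (induction n arbitrary: f)
  case 0
  have "f d = f (\<lambda>_. 0)" for d using prefix_determinedD[OF 0] by blast
  then obtain c where "f = (\<lambda>_. c)" by blast
  then show ?case by simp
next
  case (Suc n)
  have "(\<lambda>d. f (d(n := k))) \<in> borel_measurable (depth_space s)" for k
    by (rule Suc.IH, rule prefix_determinedI, rule prefix_determinedD[OF Suc.prems]) auto
  then have "(\<lambda>d. f (d(n := d n))) \<in> borel_measurable (depth_space s)"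
    using measurable_depth[of n s] by (rule measurable_compose_countable)
  then show ?case by simp
qed

lemma prefix_integrable:
  fixes f :: "(nat \<Rightarrow> nat) \<Rightarrow> real"
  assumes "prefix_determined n f" "\<And>d. \<bar>f d\<bar> \<le> B"
  shows "integrable (depth_space s) f"
proof -
  interpret prob_space "depth_space s" by (rule prob_space_depth_space)
  show ?thesis
    using assms by (intro integrable_const_bound[where B = B] prefix_measurable[of n] AE_I2) auto
qed

lemma AE_depths:
  assumes "set_pmf s \<subseteq> A"
  shows "AE d in depth_space s. \<forall>t. d t \<in> A"
  unfolding AE_all_countable depth_space_def
proof
  fix t :: nat
  show "AE d in Pi\<^sub>M UNIV (\<lambda>_. measure_pmf s). d t \<in> A"
    using assms by (intro AE_PiM_component) (auto intro!: AE_pmfI measure_pmf.prob_space_axioms)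
qed

text \<open>Following the first \<open>t\<close> depths of one sequence by an independent second
  sequence does not change the law, so Fubini separates past from future.\<close>

lemma integral_comb_seq:
  fixes f :: "(nat \<Rightarrow> nat) \<Rightarrow> real"
  assumes "f \<in> borel_measurable (depth_space s)" "\<And>d. \<bar>f d\<bar> \<le> B"
  shows "(\<integral>d. f d \<partial>depth_space s) =
    (\<integral>d. (\<integral>d'. f (comb_seq t d d') \<partial>depth_space s) \<partial>depth_space s)"
proof -
  interpret sequence_space "measure_pmf s" by (rule sequence_space_pmf)
  interpret S: prob_space "depth_space s" by (rule prob_space_depth_space)
  interpret SS: pair_prob_space "depth_space s" "depth_space s" ..
  have meas: "(\<lambda>(d, d'). comb_seq t d d') \<in> measurable (depth_space s \<Otimes>\<^sub>M depth_space s) (depth_space s)"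
    unfolding depth_space_def by (rule measurable_comb_seq)
  have "(\<integral>d. f d \<partial>depth_space s) = (\<integral>d. f d \<partial>distr (depth_space s \<Otimes>\<^sub>M depth_space s)
      (depth_space s) (\<lambda>(d, d'). comb_seq t d d'))"
    using PiM_comb_seq[of t] by (simp add: depth_space_def)
  also have "\<dots> = (\<integral>x. f (case x of (d, d') \<Rightarrow> comb_seq t d d') \<partial>(depth_space s \<Otimes>\<^sub>M depth_space s))"
    using meas assms(1) by (rule integral_distr)
  also have "\<dots> = (\<integral>d. (\<integral>d'. f (comb_seq t d d') \<partial>depth_space s) \<partial>depth_space s)"
  proof (subst SS.integral_fst'[symmetric])
    show "integrable (depth_space s \<Otimes>\<^sub>M depth_space s) (\<lambda>x. f (case x of (d, d') \<Rightarrow> comb_seq t d d'))"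
      using assms measurable_compose[OF meas assms(1)]
      by (intro SS.P.integrable_const_bound[where B = B] AE_I2) auto
  qed simp
  finally show ?thesis .
qed

lemma integral_shift:
  fixes f :: "(nat \<Rightarrow> nat) \<Rightarrow> real"
  assumes f: "prefix_determined n f" and B: "\<And>d. \<bar>f d\<bar> \<le> B"
  shows "(\<integral>d. f (shift m d) \<partial>depth_space s) = (\<integral>d. f d \<partial>depth_space s)"
proof -
  interpret S: prob_space "depth_space s" by (rule prob_space_depth_space)
  have "prefix_determined (n + m) (\<lambda>d. f (shift m d))"
    by (rule prefix_determinedI, rule prefix_determinedD[OF f]) auto
  then have "(\<integral>d. f (shift m d) \<partial>depth_space s) =
      (\<integral>d. (\<integral>d'. f (shift m (comb_seq m d d')) \<partial>depth_space s) \<partial>depth_space s)"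
    by (rule integral_comb_seq[OF prefix_measurable B])
  then show ?thesis by (simp add: comb_seq_add S.prob_space[unfolded space_depth_space])
qed

text \<open>The depth at time \<open>t\<close> is independent of the earlier ones and may be
  averaged with the past held fixed.\<close>

lemma integral_independent_depth:
  fixes H :: "(nat \<Rightarrow> nat) \<Rightarrow> nat \<Rightarrow> real"
  assumes s: "set_pmf s \<subseteq> {1..V}"
    and H: "\<And>k. prefix_determined t (\<lambda>d. H d k)" and B: "\<And>d k. \<bar>H d k\<bar> \<le> B"
  shows "(\<integral>d. H d (d t) \<partial>depth_space s) = (\<integral>d. (\<Sum>k=1..V. pmf s k * H d k) \<partial>depth_space s)"
proof -
  interpret sequence_space "measure_pmf s" by (rule sequence_space_pmf)
  have "prefix_determined (Suc t) (\<lambda>d. H d (d t))"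
  proof (rule prefix_determinedI)
    fix d d' :: "nat \<Rightarrow> nat" assume "\<And>i. i < Suc t \<Longrightarrow> d i = d' i"
    then show "H d (d t) = H d' (d' t)" using prefix_determinedD[OF H[of "d t"], of d d'] by simp
  qed
  then have "(\<integral>d. H d (d t) \<partial>depth_space s) =
      (\<integral>d. (\<integral>d'. H (comb_seq t d d') (comb_seq t d d' t) \<partial>depth_space s) \<partial>depth_space s)"
    by (rule integral_comb_seq[OF prefix_measurable B])
  also have "\<dots> = (\<integral>d. (\<Sum>k=1..V. pmf s k * H d k) \<partial>depth_space s)"
  proof (rule Bochner_Integration.integral_cong[OF refl])
    fix d :: "nat \<Rightarrow> nat"
    have "comb_seq t d d' t = d' 0" for d' :: "nat \<Rightarrow> nat" using comb_seq_add[of t d d' 0] by simp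
    moreover have "H (comb_seq t d d') k = H d k" for d' k
      by (rule prefix_determinedD[OF H]) (simp add: comb_seq_less)
    ultimately have "(\<integral>d'. H (comb_seq t d d') (comb_seq t d d' t) \<partial>depth_space s)
        = (\<integral>d'. H d (d' 0) \<partial>depth_space s)" by simp
    also have "\<dots> = (\<integral>k. H d k \<partial>distr (depth_space s) (measure_pmf s) (\<lambda>d'. d' 0))"
      unfolding depth_space_def by (rule integral_distr[symmetric]) simp_all
    also have "distr (depth_space s) (measure_pmf s) (\<lambda>d'. d' 0) = measure_pmf s"
      unfolding depth_space_def using PiM_component[of 0] by simp
    also have "(\<integral>k. H d k \<partial>measure_pmf s) = (\<Sum>k=1..V. pmf s k * H d k)"
      by (subst integral_measure_pmf[of "{1..V}"]) (use s in auto)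
    finally show "(\<integral>d'. H (comb_seq t d d') (comb_seq t d d' t) \<partial>depth_space s)
        = (\<Sum>k=1..V. pmf s k * H d k)" .
  qed
  finally show ?thesis .
qed

section \<open>The miss rate of OPT\<close>

definition tail_prob :: "nat \<Rightarrow> nat pmf \<Rightarrow> nat \<Rightarrow> real" where
  "tail_prob V s k = (\<Sum>j\<in>{k<..V}. pmf s j)"

lemma sum_pmf_support: "set_pmf s \<subseteq> {1..V} \<Longrightarrow> (\<Sum>k=1..V. pmf s (k::nat)) = 1"
  by (rule sum_pmf_eq_1) auto

lemma prefix_determined_misses_opt:
  assumes "C \<ge> 1"
  shows "prefix_determined n (\<lambda>d. real (misses C \<Lambda> (opt \<Lambda>) d n))"
proof (rule prefix_determinedI)
  fix d d' :: "nat \<Rightarrow> nat" assume "\<And>i. i < n \<Longrightarrow> d i = d' i"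
  then have "misses C \<Lambda> (opt \<Lambda>) d n = misses C \<Lambda> (opt \<Lambda>) d' n"
    by (rule misses_opt_prefix[OF assms])
  then show "real (misses C \<Lambda> (opt \<Lambda>) d n) = real (misses C \<Lambda> (opt \<Lambda>) d' n)" by simp
qed

lemma integrable_misses_opt:
  assumes "C \<ge> 1"
  shows "integrable (depth_space s) (\<lambda>d. real (misses C \<Lambda> (opt \<Lambda>) d n))"
  by (rule prefix_integrable[OF prefix_determined_misses_opt[OF assms], where B = n])
    (simp add: misses_eq_faults faults_le)

lemma distinct_count_prefix:
  "(\<And>i. i < t \<Longrightarrow> d i = d' i) \<Longrightarrow> distinct_count d t = distinct_count d' t"
  by (induction t) auto

lemma distinct_count_le_time: "distinct_count d t \<le> t"
  by (induction t) (auto simp: of_bool_def)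

lemma prefix_determined_distinct_count: "prefix_determined t (\<lambda>d. f (distinct_count d t))"
proof (rule prefix_determinedI)
  fix d d' :: "nat \<Rightarrow> nat" assume "\<And>i. i < t \<Longrightarrow> d i = d' i"
  then have "distinct_count d t = distinct_count d' t" by (rule distinct_count_prefix)
  then show "f (distinct_count d t) = f (distinct_count d' t)" by simp
qed

lemma integrable_distinct_count:
  "integrable (depth_space s) (\<lambda>d. real (distinct_count d t))"
  by (rule prefix_integrable[OF prefix_determined_distinct_count, where B = t])
    (simp add: distinct_count_le_time)

text \<open>Compare with never evicting anything, which is legal as all items fit; it faults once
  per distinct item.\<close>

lemma misses_opt_le_items:
  assumes C: "C \<ge> 1" "V \<le> C" and inj: "inj_on \<Lambda> {1..V}" and d: "\<And>i. d i \<in> {1..V}"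
  shows "misses C \<Lambda> (opt \<Lambda>) d n \<le> V"
proof -
  let ?x = "accessed \<Lambda> d" and ?P = "\<lambda>t. accessed \<Lambda> d ` {..<t}"
  have bij: "bij_betw \<Lambda> {1..V} (\<Lambda> ` {1..V})" using inj by (simp add: bij_betw_def)
  have card: "card (?P t) \<le> V" for t
    using card_accessed[OF bij, of t d] distinct_count_le[of t d V] d by simp
  have "demand_paging C ?x n ?P"
    using card C by (auto simp: demand_paging_def lessThan_Suc intro: order_trans)
  from opt_optimal[OF C(1) this] have "misses C \<Lambda> (opt \<Lambda>) d n \<le> faults ?x ?P n" .
  also have "faults ?x ?P n = card (?P n)"
    by (induction n) (simp_all add: faults_Suc lessThan_Suc card_insert_if)
  also have "\<dots> \<le> V" by (rule card)
  finally show ?thesis .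
qed

lemma misses_opt_window:
  assumes C: "C \<ge> 1" and inj: "inj_on \<Lambda> {1..V}" and d: "\<And>i. d i \<in> {1..V}"
  shows "distinct_count (shift m d) T + misses C \<Lambda> (opt \<Lambda>) d m \<le> C + misses C \<Lambda> (opt \<Lambda>) d (m + T)"
proof -
  have bij: "bij_betw \<Lambda> {1..V} (\<Lambda> ` {1..V})" using inj by (simp add: bij_betw_def)
  have bij': "bij_betw (lru_stack \<Lambda> d m) {1..V} (\<Lambda> ` {1..V})"
    by (rule bij_betw_lru_stack[OF bij]) (rule d)
  have "accessed \<Lambda> d ` {m..<m + T} = (\<lambda>t. accessed \<Lambda> d (m + t)) ` {..<T}"
    unfolding image_image[symmetric] by (rule arg_cong[where f = "image _"])
      (simp add: lessThan_atLeast0 add.commute)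
  then have "card (accessed \<Lambda> d ` {m..<m + T}) = distinct_count (shift m d) T"
    using card_accessed[OF bij', of T "shift m d"] d by (simp add: accessed_shift)
  with distinct_le_faults[OF demand_paging_opt[OF C, of \<Lambda> d "m + T"], of m T]
  show ?thesis by (simp add: misses_eq_faults)
qed

text \<open>Subadditivity of the expected misses makes the limit exist by Fekete's lemma. A total
  bounded by \<open>V\<close> then gives 0, and counting over consecutive windows of length
  \<open>T\<close> gives the lower bound.\<close>

lemma
  assumes C: "C \<ge> 1" and inj: "inj_on \<Lambda> {1..V}" and s: "set_pmf s \<subseteq> {1..V}"
  shows miss_rate_opt_eq_0: "V \<le> C \<Longrightarrow> M_OPT s C \<Lambda> = 0"
    and miss_rate_opt_ge: "T \<ge> 1 \<Longrightarrow>
      ((\<integral>d. real (distinct_count d T) \<partial>depth_space s) - real C) / real T \<le> M_OPT s C \<Lambda>"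
proof -
  interpret prob_space "depth_space s" by (rule prob_space_depth_space)
  define f where "f n = (\<integral>d. real (misses C \<Lambda> (opt \<Lambda>) d n) \<partial>depth_space s)" for n
  have ae: "AE d in depth_space s. \<forall>t. d t \<in> {1..V}" by (rule AE_depths[OF s])
  have pd: "prefix_determined n (\<lambda>d. real (misses C \<Lambda> (opt \<Lambda>) d n))" for n
    by (rule prefix_determined_misses_opt[OF C])
  have int: "integrable (depth_space s) (\<lambda>d. real (misses C \<Lambda> (opt \<Lambda>) d n))" for n
    by (rule integrable_misses_opt[OF C])
  have bound: "\<bar>real (misses C \<Lambda> (opt \<Lambda>) d n)\<bar> \<le> real n" for d n
    by (simp add: misses_eq_faults faults_le)
  have "f (m + n) \<le> f m + f n" for m n
  proof -
    have pd': "prefix_determined (n + m) (\<lambda>d. real (misses C \<Lambda> (opt \<Lambda>) (shift m d) n))"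
    proof (rule prefix_determinedI)
      fix d d' :: "nat \<Rightarrow> nat" assume "\<And>i. i < n + m \<Longrightarrow> d i = d' i"
      then show "real (misses C \<Lambda> (opt \<Lambda>) (shift m d) n) = real (misses C \<Lambda> (opt \<Lambda>) (shift m d') n)"
        using misses_opt_prefix[OF C, of n "shift m d" "shift m d'"] by simp
    qed
    have int': "integrable (depth_space s) (\<lambda>d. real (misses C \<Lambda> (opt \<Lambda>) (shift m d) n))"
      by (rule prefix_integrable[OF pd' bound])
    have "f (m + n) \<le> (\<integral>d. real (misses C \<Lambda> (opt \<Lambda>) d m)
        + real (misses C \<Lambda> (opt \<Lambda>) (shift m d) n) \<partial>depth_space s)"
      unfolding f_def
    proof (rule integral_mono_AE[OF int Bochner_Integration.integrable_add[OF int int']])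
      from ae show "AE d in depth_space s. real (misses C \<Lambda> (opt \<Lambda>) d (m + n))
          \<le> real (misses C \<Lambda> (opt \<Lambda>) d m) + real (misses C \<Lambda> (opt \<Lambda>) (shift m d) n)"
      proof eventually_elim
        case (elim d)
        then have "misses C \<Lambda> (opt \<Lambda>) d (m + n)
            \<le> misses C \<Lambda> (opt \<Lambda>) d m + misses C \<Lambda> (opt \<Lambda>) (shift m d) n"
          by (intro misses_opt_subadditive[OF C inj]) blast
        then show ?case by linarith
      qed
    qed
    also have "\<dots> = f m + f n"
      unfolding f_def using int int' integral_shift[OF pd bound, where m = m] by simp
    finally show ?thesis .
  qed
  moreover have f0: "0 \<le> f n" for n unfolding f_def by simp
  ultimately obtain L where L: "(\<lambda>n. f n / real n) \<longlonglongrightarrow> L"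
    using fekete_nonneg[of f] by blast
  have M: "M_OPT s C \<Lambda> = L"
    unfolding M_OPT_def miss_rate_def using limI[OF L] by (simp add: f_def)
  have nn: "0 \<le> L"
    by (rule LIMSEQ_le_const[OF L]) (use f0 in auto)
  show "M_OPT s C \<Lambda> = 0" if "V \<le> C"
  proof -
    have "f n \<le> real V" for n
    proof -
      have "f n \<le> (\<integral>d. real V \<partial>depth_space s)"
        unfolding f_def
      proof (rule integral_mono_AE[OF int])
        from ae show "AE d in depth_space s. real (misses C \<Lambda> (opt \<Lambda>) d n) \<le> real V"
        proof eventually_elim
          case (elim d)
          then have "misses C \<Lambda> (opt \<Lambda>) d n \<le> V"
            by (intro misses_opt_le_items[OF C that inj]) blast
          then show ?case by simp
        qed
      qed simp
      then show ?thesis using prob_space by simp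
    qed
    then have "f n / real n \<le> real V / real n" for n by (simp add: divide_right_mono)
    then have "L \<le> 0"
      using LIMSEQ_le[OF L lim_const_over_n[of "real V"]] by blast
    with nn show ?thesis by (simp add: M)
  qed
  show "((\<integral>d. real (distinct_count d T) \<partial>depth_space s) - real C) / real T \<le> M_OPT s C \<Lambda>" if T: "T \<ge> 1"
  proof -
    define e where "e = (\<integral>d. real (distinct_count d T) \<partial>depth_space s) - real C"
    have pdc: "prefix_determined T (\<lambda>d. real (distinct_count d T))"
      by (rule prefix_determined_distinct_count)
    have bdc: "\<bar>real (distinct_count d T)\<bar> \<le> real T" for d by (simp add: distinct_count_le_time)
    have step: "e + f m \<le> f (m + T)" for m
    proof -
      have pdc': "prefix_determined (T + m) (\<lambda>d. real (distinct_count (shift m d) T))"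
      proof (rule prefix_determinedI)
        fix d d' :: "nat \<Rightarrow> nat" assume "\<And>i. i < T + m \<Longrightarrow> d i = d' i"
        then show "real (distinct_count (shift m d) T) = real (distinct_count (shift m d') T)"
          using distinct_count_prefix[of T "shift m d" "shift m d'"] by simp
      qed
      have int': "integrable (depth_space s) (\<lambda>d. real (distinct_count (shift m d) T))"
        by (rule prefix_integrable[OF pdc' bdc])
      have "(\<integral>d. real (distinct_count (shift m d) T) + real (misses C \<Lambda> (opt \<Lambda>) d m) \<partial>depth_space s)
          \<le> (\<integral>d. real C + real (misses C \<Lambda> (opt \<Lambda>) d (m + T)) \<partial>depth_space s)"
      proof (rule integral_mono_AE)
        from ae show "AE d in depth_space s. real (distinct_count (shift m d) T)
            + real (misses C \<Lambda> (opt \<Lambda>) d m) \<le> real C + real (misses C \<Lambda> (opt \<Lambda>) d (m + T))"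
        proof eventually_elim
          case (elim d)
          then have "distinct_count (shift m d) T + misses C \<Lambda> (opt \<Lambda>) d m
              \<le> C + misses C \<Lambda> (opt \<Lambda>) d (m + T)"
            by (intro misses_opt_window[OF C inj]) blast
          then show ?case by linarith
        qed
      qed (use int int' in auto)
      then show ?thesis
        using int int' integral_shift[OF pdc bdc, where m = m] prob_space
        by (simp add: f_def e_def)
    qed
    \<comment> \<open>Each of the \<open>q\<close> consecutive windows adds at least
      \<open>e\<close>, because shifted depths have the same law.\<close>
    have "real q * e \<le> f (q * T)" for q
    proof (induction q)
      case 0
      show ?case by (simp add: f0)
    next
      case (Suc q)
      then show ?case using step[of "q * T"] by (simp add: algebra_simps)
    qed
    then have ge: "e / real T \<le> f (q * T) / real (q * T)" if "q \<ge> 1" for q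
    proof -
      have "e / real T = real q * e / real (q * T)" using that by simp
      also have "\<dots> \<le> f (q * T) / real (q * T)"
        by (rule divide_right_mono[OF \<open>real q * e \<le> f (q * T)\<close>]) simp
      finally show ?thesis .
    qed
    have "(\<lambda>q. f (q * T) / real (q * T)) \<longlonglongrightarrow> L"
      using LIMSEQ_subseq_LIMSEQ[OF L, of "\<lambda>q. q * T"] T by (simp add: strict_mono_def comp_def)
    from LIMSEQ_le_const[OF this] ge show ?thesis unfolding M e_def by blast
  qed
qed

text \<open>At count \<open>k\<close> the expected growth is \<open>tail_prob V s k\<close>, so the
  gap between \<open>A\<close> and the expected count shrinks by the factor \<open>1 - b\<close> per
  access. The first access is always new, whence the initial gap \<open>A - 1\<close>.\<close>

lemma distinct_count_expectation:
  assumes s: "set_pmf s \<subseteq> {1..V}" and b: "0 \<le> b" "b \<le> 1"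
    and tail: "\<And>k. k \<in> {1..V} \<Longrightarrow> b * (A - real k) \<le> tail_prob V s k"
  shows "A - (\<integral>d. real (distinct_count d (Suc t)) \<partial>depth_space s) \<le> (A - 1) * (1 - b) ^ t"
proof -
  interpret prob_space "depth_space s" by (rule prob_space_depth_space)
  define e where "e t = (\<integral>d. real (distinct_count d t) \<partial>depth_space s)" for t
  have ae: "AE d in depth_space s. \<forall>t. d t \<in> {1..V}" by (rule AE_depths[OF s])
  have int: "integrable (depth_space s) (\<lambda>d. real (distinct_count d t))" for t
    by (rule integrable_distinct_count)
  have step: "e (Suc t) = (\<integral>d. real (distinct_count d t) + tail_prob V s (distinct_count d t) \<partial>depth_space s)" for t
  proof -
    define H where "H = (\<lambda>d k. real (distinct_count d t) + of_bool (k > distinct_count d t))"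
    have "e (Suc t) = (\<integral>d. H d (d t) \<partial>depth_space s)" by (simp add: e_def H_def)
    also have "\<dots> = (\<integral>d. (\<Sum>k=1..V. pmf s k * H d k) \<partial>depth_space s)"
    proof (rule integral_independent_depth[OF s])
      show "prefix_determined t (\<lambda>d. H d k)" for k
      proof (rule prefix_determinedI)
        fix d d' :: "nat \<Rightarrow> nat" assume "\<And>i. i < t \<Longrightarrow> d i = d' i"
        then show "H d k = H d' k" using distinct_count_prefix[of t d d'] by (simp add: H_def)
      qed
      show "\<bar>H d k\<bar> \<le> real t + 1" for d k
        using distinct_count_le_time[of d t] by (auto simp: H_def)
    qed
    also have "(\<lambda>d. \<Sum>k=1..V. pmf s k * H d k)
        = (\<lambda>d. real (distinct_count d t) + tail_prob V s (distinct_count d t))"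
    proof
      fix d
      let ?n = "distinct_count d t"
      have "(\<Sum>k=1..V. pmf s k * H d k)
          = real ?n * (\<Sum>k=1..V. pmf s k) + (\<Sum>k=1..V. if k > ?n then pmf s k else 0)"
        unfolding sum_distrib_left sum.distrib[symmetric]
        by (rule sum.cong) (auto simp: H_def algebra_simps)
      also have "(\<Sum>k=1..V. if k > ?n then pmf s k else 0) = tail_prob V s ?n"
        unfolding tail_prob_def by (subst sum.inter_filter[symmetric]) (auto intro!: sum.cong)
      finally show "(\<Sum>k=1..V. pmf s k * H d k) = real ?n + tail_prob V s ?n"
        using sum_pmf_support[OF s] by simp
    qed
    finally show ?thesis .
  qed
  \<comment> \<open>The tail bound is available for counts from 1 on only, so the recursion starts
    after the first access.\<close>
  have pos: "distinct_count d (Suc t) \<ge> 1" if "d 0 \<ge> 1" for d t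
    using that by (induction t) auto
  have "A - e (Suc t) \<le> (A - 1) * (1 - b) ^ t"
  proof (induction t)
    case 0
    have "e (Suc 0) = (\<integral>d. 1 \<partial>depth_space s)"
      unfolding e_def
    proof (rule integral_cong_AE)
      from ae show "AE d in depth_space s. real (distinct_count d (Suc 0)) = 1"
      proof eventually_elim
        case (elim d)
        from elim[rule_format, of 0] show ?case by simp
      qed
    qed (rule borel_measurable_integrable[OF int], simp)
    then show ?case using prob_space by simp
  next
    case (Suc t)
    have "(\<integral>d. b * A + (1 - b) * real (distinct_count d (Suc t)) \<partial>depth_space s) \<le> e (Suc (Suc t))"
      unfolding step[of "Suc t"]
    proof (rule integral_mono_AE)
      have "prefix_determined (Suc t) (\<lambda>d. tail_prob V s (distinct_count d (Suc t)))"
        by (rule prefix_determined_distinct_count)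
      moreover have "\<bar>tail_prob V s n\<bar> \<le> (\<Sum>j\<le>V. pmf s j)" for n
        unfolding tail_prob_def by (subst abs_of_nonneg) (auto intro!: sum_nonneg sum_mono2)
      ultimately show "integrable (depth_space s)
          (\<lambda>d. real (distinct_count d (Suc t)) + tail_prob V s (distinct_count d (Suc t)))"
        using int by (intro Bochner_Integration.integrable_add) (auto intro: prefix_integrable simp del: distinct_count.simps)
      show "integrable (depth_space s) (\<lambda>d. b * A + (1 - b) * real (distinct_count d (Suc t)))"
        using int[of "Suc t"] by (simp del: distinct_count.simps)
      from ae show "AE d in depth_space s. b * A + (1 - b) * real (distinct_count d (Suc t))
          \<le> real (distinct_count d (Suc t)) + tail_prob V s (distinct_count d (Suc t))"
      proof eventually_elim
        case (elim d)
        let ?n = "distinct_count d (Suc t)"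
        have "?n \<in> {1..V}"
          using pos[of d t] distinct_count_le[of "Suc t" d V] elim by (simp del: distinct_count.simps)
        from tail[OF this] show ?case by (simp add: algebra_simps del: distinct_count.simps)
      qed
    qed
    also have "(\<integral>d. b * A + (1 - b) * real (distinct_count d (Suc t)) \<partial>depth_space s)
        = b * A + (1 - b) * e (Suc t)"
      using int[of "Suc t"] prob_space by (simp add: e_def del: distinct_count.simps)
    finally have "A - e (Suc (Suc t)) \<le> (1 - b) * (A - e (Suc t))" by (simp add: algebra_simps)
    also have "\<dots> \<le> (1 - b) * ((A - 1) * (1 - b) ^ t)"
      using Suc b by (intro mult_left_mono) auto
    finally show ?case by (simp add: mult_ac)
  qed
  then show ?thesis by (simp only: e_def)
qed

section \<open>Profit rates and the concave majorant\<close>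

text \<open>
  \<open>\<beta>\<close> is the slope, to the right of \<open>C\<close>, of the least concave majorant on \<open>{1..V}\<close> of the
  distribution function, and \<open>K \<le> C < L\<close> are the ends of the edge with that slope.
\<close>

locale lpr_model =
  fixes V C :: nat and s :: "nat pmf"
  assumes C: "1 \<le> C" "C < V" and supp: "set_pmf s \<subseteq> {1..V}" and last_pos: "pmf s V > 0"
begin

definition cum :: "nat \<Rightarrow> real" where "cum j = (\<Sum>k=1..j. pmf s k)"

text \<open>With this shift of the index, \<open>\<xi> k\<close> is the steepest slope of a chord of
  \<open>cum\<close> leaving \<open>k\<close> to the right.\<close>

definition \<xi> :: "nat \<Rightarrow> real" where "\<xi> k = profit_rate V s (Suc k)"

definition \<beta> :: real where "\<beta> = Min (\<xi> ` {1..C})"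

text \<open>Taking the least minimizer matches the tie-breaking of LPR towards the top.\<close>

definition K :: nat where "K = (LEAST k. k \<in> {1..C} \<and> \<xi> k = \<beta>)"

definition L :: nat where "L = Max {j \<in> {K<..V}. cum j - cum K = \<beta> * (real j - real K)}"

text \<open>How far the line through the edge stays below 1 at \<open>C\<close>;
  \<open>M_LPR_eq\<close> identifies this with the miss rate of LPR.\<close>

definition M :: real where "M = 1 - cum K - \<beta> * (real C - real K)"

lemma cum_V: "cum V = 1"
  unfolding cum_def by (rule sum_pmf_support[OF supp])

lemma cum_diff: "k \<le> j \<Longrightarrow> (\<Sum>i=Suc k..j. pmf s i) = cum j - cum k"
  unfolding cum_def using sum.ub_add_nat[of 1 k "pmf s" "j - k"] by simp

lemma tail_prob_eq: "k \<le> V \<Longrightarrow> tail_prob V s k = 1 - cum k"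
  using cum_diff[of k V] cum_V by (simp add: tail_prob_def atLeastSucAtMost_greaterThanAtMost)

lemma tail_prob_pos: "k < V \<Longrightarrow> tail_prob V s k > 0"
  unfolding tail_prob_def using last_pos by (intro sum_pos2[of _ V]) auto

lemma avg_prob_eq: "k < j \<Longrightarrow> avg_prob s (Suc k) j = (cum j - cum k) / (real j - real k)"
  by (simp add: avg_prob_def cum_diff)

lemma \<xi>_ge: "k < j \<Longrightarrow> j \<le> V \<Longrightarrow> cum j - cum k \<le> \<xi> k * (real j - real k)"
proof -
  assume j: "k < j" "j \<le> V"
  then have "avg_prob s (Suc k) j \<le> \<xi> k"
    unfolding \<xi>_def profit_rate_def by (intro Max_ge) auto
  then show ?thesis using j by (simp add: avg_prob_eq field_simps)
qed

lemma \<xi>_attained: "k < V \<Longrightarrow> \<exists>j\<in>{k<..V}. cum j - cum k = \<xi> k * (real j - real k)"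
proof -
  assume k: "k < V"
  then have "\<xi> k \<in> avg_prob s (Suc k) ` {Suc k..V}"
    unfolding \<xi>_def profit_rate_def by (intro Max_in) auto
  then obtain j where "j \<in> {Suc k..V}" "\<xi> k = avg_prob s (Suc k) j" by auto
  then show ?thesis by (intro bexI[of _ j]) (auto simp: avg_prob_eq)
qed

lemma \<beta>_le: "k \<in> {1..C} \<Longrightarrow> \<beta> \<le> \<xi> k"
  unfolding \<beta>_def by (intro Min_le) auto

lemma K: "1 \<le> K" "K \<le> C" "\<xi> K = \<beta>"
proof -
  have "\<beta> \<in> \<xi> ` {1..C}" unfolding \<beta>_def using C by (intro Min_in) auto
  then obtain k where "k \<in> {1..C} \<and> \<xi> k = \<beta>" by auto
  then have "K \<in> {1..C} \<and> \<xi> K = \<beta>" unfolding K_def by (rule LeastI)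
  then show "1 \<le> K" "K \<le> C" "\<xi> K = \<beta>" by auto
qed

lemma \<beta>_less: "1 \<le> k \<Longrightarrow> k < K \<Longrightarrow> \<beta> < \<xi> k"
proof -
  assume k: "1 \<le> k" "k < K"
  then have kC: "k \<in> {1..C}" using K by auto
  with k have "\<xi> k \<noteq> \<beta>" unfolding K_def using not_less_Least by blast
  with \<beta>_le[OF kC] show ?thesis by simp
qed

lemma cum_line_right: "K \<le> k \<Longrightarrow> k \<le> V \<Longrightarrow> cum k - cum K \<le> \<beta> * (real k - real K)"
  using \<xi>_ge[of K k] K(3) by (cases "k = K") auto

lemma L: "K < L" "L \<le> V" "cum L - cum K = \<beta> * (real L - real K)"
  and L_max: "\<And>j. L < j \<Longrightarrow> j \<le> V \<Longrightarrow> cum j - cum K < \<beta> * (real j - real K)"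
proof -
  let ?A = "{j \<in> {K<..V}. cum j - cum K = \<beta> * (real j - real K)}"
  have "?A \<noteq> {}" using \<xi>_attained[of K] K C by auto
  then have "L \<in> ?A" unfolding L_def by (intro Max_in) auto
  then show L: "K < L" "L \<le> V" "cum L - cum K = \<beta> * (real L - real K)" by auto
  fix j assume j: "L < j" "j \<le> V"
  have "j \<notin> ?A"
  proof
    assume "j \<in> ?A"
    then have "j \<le> L" unfolding L_def by (intro Max_ge) auto
    with j show False by simp
  qed
  with j L have "cum j - cum K \<noteq> \<beta> * (real j - real K)" by auto
  with cum_line_right[of j] j L show "cum j - cum K < \<beta> * (real j - real K)" by auto
qed

text \<open>A chord from \<open>L\<close> of slope at least \<open>\<beta>\<close> would end on or
  above the line through the edge, beyond its last contact point.\<close>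

lemma \<xi>_L_less: "L < V \<Longrightarrow> \<xi> L < \<beta>"
proof -
  assume "L < V"
  then obtain j where j: "L < j" "j \<le> V" "cum j - cum L = \<xi> L * (real j - real L)"
    using \<xi>_attained[of L] by (metis greaterThanAtMost_iff)
  have "\<xi> L * (real j - real L) < \<beta> * (real j - real L)"
    using L_max[OF j(1,2)] L(3) j(3) by (simp add: algebra_simps)
  then show ?thesis using j(1) by simp
qed

lemma C_less_L: "C < L"
proof (rule ccontr)
  assume "\<not> C < L"
  then have "\<xi> L < \<beta>" "L \<in> {1..C}" using \<xi>_L_less C L K by auto
  with \<beta>_le show False by fastforce
qed

text \<open>The chord from \<open>k\<close> to \<open>L\<close> starts on or below the line and ends
  on it.\<close>

lemma \<beta>_le_\<xi>: "K \<le> k \<Longrightarrow> k < L \<Longrightarrow> \<beta> \<le> \<xi> k"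
proof -
  assume k: "K \<le> k" "k < L"
  have "\<beta> * (real L - real k) \<le> cum L - cum k"
    using cum_line_right[of k] k L by (simp add: algebra_simps)
  also have "\<dots> \<le> \<xi> k * (real L - real k)" using \<xi>_ge k L by simp
  finally show ?thesis using k by simp
qed

text \<open>The line through the edge dominates \<open>cum\<close> on all of \<open>{1..V}\<close>.
  Left of \<open>K\<close>, follow the steepest chord: its slope exceeds \<open>\<beta>\<close> and
  its right end satisfies the bound by induction.\<close>

lemma cum_line: "1 \<le> k \<Longrightarrow> k \<le> V \<Longrightarrow> cum k \<le> cum K + \<beta> * (real k - real K)"
proof (induction "V - k" arbitrary: k rule: less_induct)
  case less
  show ?case
  proof (cases "k < K")
    case True
    obtain j where j: "k < j" "j \<le> V" "cum j - cum k = \<xi> k * (real j - real k)"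
      using \<xi>_attained[of k] True K C by auto
    have "\<beta> * (real j - real k) \<le> cum j - cum k"
      using \<beta>_less[of k] True less.prems j by (simp add: mult_right_mono)
    moreover have "cum j \<le> cum K + \<beta> * (real j - real K)"
      using j less.prems by (intro less.hyps) auto
    ultimately show ?thesis by (simp add: algebra_simps)
  next
    case False
    then show ?thesis using cum_line_right[of k] less.prems by simp
  qed
qed

lemma \<beta>_pos: "0 < \<beta>"
proof -
  have "0 < cum V - cum K" using tail_prob_pos[of K] tail_prob_eq[of K] cum_V K C by simp
  also have "\<dots> \<le> \<beta> * (real V - real K)" using cum_line_right[of V] K C by simp
  finally show ?thesis using K C by (simp add: zero_less_mult_iff)
qed

lemma tail_prob_line: "1 \<le> k \<Longrightarrow> k \<le> V \<Longrightarrow> M - \<beta> * (real k - real C) \<le> tail_prob V s k"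
  using cum_line[of k] by (simp add: tail_prob_eq M_def algebra_simps)

lemma tail_prob_nonneg: "0 \<le> tail_prob V s k"
  unfolding tail_prob_def by (rule sum_nonneg) simp

text \<open>The line is still at most 1 at \<open>L\<close>, which lies at least one step to the
  right of \<open>C\<close>.\<close>

lemma \<beta>_le_M: "\<beta> \<le> M"
proof -
  have "0 \<le> 1 - cum L" using tail_prob_nonneg[of L] tail_prob_eq[of L] L by simp
  also have "\<dots> = M - \<beta> * (real L - real C)" using L(3) by (simp add: M_def algebra_simps)
  finally have "\<beta> * (real L - real C) \<le> M" by simp
  moreover have "\<beta> * 1 \<le> \<beta> * (real L - real C)"
    using \<beta>_pos C_less_L by (intro mult_left_mono) auto
  ultimately show ?thesis by simp
qed

text \<open>At depth 1 the line is nonnegative, since it dominates \<open>cum\<close> there.\<close>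

lemma M_le: "M + \<beta> * (real C - 1) \<le> 1"
proof -
  have "M + \<beta> * (real C - 1) \<le> 1 - cum 1"
    using cum_line[of 1] C by (simp add: M_def algebra_simps)
  also have "\<dots> \<le> 1" by (simp add: cum_def)
  finally show ?thesis .
qed

text \<open>\<open>\<xi> L\<close> lies strictly below all earlier values, so depth
  \<open>Suc L\<close> is chosen whenever it is buffered. Otherwise the minimum is
  \<open>\<beta>\<close>, attained at \<open>K\<close> and strictly exceeded before it.\<close>

lemma evicted_depth:
  assumes "{2..Suc K} \<subseteq> D" "D \<subseteq> {2..min V (Suc L)}"
  shows "(LEAST i. i \<in> D \<and> (\<forall>j\<in>D. profit_rate V s i \<le> profit_rate V s j))
    = (if Suc L \<in> D then Suc L else Suc K)"
proof -
  have shift: "\<exists>k. i = Suc k \<and> 1 \<le> k \<and> k < V \<and> k \<le> L" if "i \<in> D" for i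
    using that assms(2) by (cases i) auto
  have KD: "Suc K \<in> D" using assms(1) K by auto
  have ge: "\<beta> \<le> \<xi> k" if "1 \<le> k" "k < L" for k
    using that \<beta>_less[of k] \<beta>_le_\<xi>[of k] by (cases "k < K") auto
  show ?thesis
  proof (cases "Suc L \<in> D")
    case True
    then have "L < V" using assms(2) by auto
    note less = \<xi>_L_less[OF this]
    have lt: "\<xi> L < \<xi> k" if "1 \<le> k" "k < L" for k using ge[OF that] less by simp
    have min: "profit_rate V s (Suc L) \<le> profit_rate V s j" if "j \<in> D" for j
    proof -
      from shift[OF that] obtain k where k: "j = Suc k" "1 \<le> k" "k \<le> L" by auto
      then show ?thesis using lt[of k] by (cases "k = L") (auto simp: \<xi>_def)
    qed
    have "(LEAST i. i \<in> D \<and> (\<forall>j\<in>D. profit_rate V s i \<le> profit_rate V s j)) = Suc L"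
    proof (rule Least_equality)
      fix i assume i: "i \<in> D \<and> (\<forall>j\<in>D. profit_rate V s i \<le> profit_rate V s j)"
      then obtain k where k: "i = Suc k" "1 \<le> k" "k \<le> L" using shift by blast
      have "\<xi> k \<le> \<xi> L" using i True k by (simp add: \<xi>_def)
      with lt[of k] k show "Suc L \<le> i" by (cases "k = L") auto
    qed (use True min in auto)
    with True show ?thesis by simp
  next
    case False
    have below: "k < L" if "Suc k \<in> D" for k
      using shift[OF that] that False by (cases "k = L") auto
    have "(LEAST i. i \<in> D \<and> (\<forall>j\<in>D. profit_rate V s i \<le> profit_rate V s j)) = Suc K"
    proof (rule Least_equality)
      have "profit_rate V s (Suc K) \<le> profit_rate V s j" if j: "j \<in> D" for j
      proof -
        from shift[OF j] obtain k where k: "j = Suc k" "1 \<le> k" by auto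
        then show ?thesis using ge[of k] below[of k] j K(3) by (simp add: \<xi>_def)
      qed
      then show "Suc K \<in> D \<and> (\<forall>j\<in>D. profit_rate V s (Suc K) \<le> profit_rate V s j)"
        using KD by blast
    next
      fix i assume i: "i \<in> D \<and> (\<forall>j\<in>D. profit_rate V s i \<le> profit_rate V s j)"
      then obtain k where k: "i = Suc k" "1 \<le> k" using shift by blast
      have "profit_rate V s i \<le> profit_rate V s (Suc K)" using i KD by blast
      then have "\<xi> k \<le> \<beta>" using k K(3) by (simp add: \<xi>_def)
      with \<beta>_less[of k] k show "Suc K \<le> i" by (cases "k < K") auto
    qed
    with False show ?thesis by simp
  qed
qed

end

section \<open>The depths buffered by LPR\<close>

lemma least_minimizer_in:
  fixes f :: "nat \<Rightarrow> real"
  assumes "finite A" "A \<noteq> {}"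
  shows "(LEAST i. i \<in> A \<and> (\<forall>j\<in>A. f i \<le> f j)) \<in> A"
proof -
  obtain i where "is_arg_min f (\<lambda>x. x \<in> A) i"
    using ex_is_arg_min_if_finite[OF assms] by blast
  then have "i \<in> A \<and> (\<forall>j\<in>A. f i \<le> f j)" by (simp add: is_arg_min_linorder)
  from LeastI[of "\<lambda>i. i \<in> A \<and> (\<forall>j\<in>A. f i \<le> f j)", OF this] show ?thesis by blast
qed

context lpr_model
begin

text \<open>\<open>move_to_top\<close> applied to the identity sends a new depth to the former depth
  of the same item, so a set of depths moves by taking its preimage.\<close>

definition moved_depths :: "nat set \<Rightarrow> nat \<Rightarrow> nat set" where
  "moved_depths D k = {i \<in> {1..V}. move_to_top (\<lambda>j. j) k i \<in> D}"

definition next_depths :: "nat set \<Rightarrow> nat \<Rightarrow> nat set" where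
  "next_depths D k =
    (let D' = moved_depths D k in
      if k \<in> D then D'
      else if card D < C then insert 1 D'
      else insert 1 (D' - {LEAST i. i \<in> D' \<and> (\<forall>j\<in>D'. profit_rate V s i \<le> profit_rate V s j)}))"

text \<open>
  The set of LRU depths of the items buffered by LPR; it does not depend on the initial stack.
\<close>

primrec lpr_depths :: "(nat \<Rightarrow> nat) \<Rightarrow> nat \<Rightarrow> nat set" where
  "lpr_depths d 0 = {}"
| "lpr_depths d (Suc t) = next_depths (lpr_depths d t) (d t)"

lemma next_depths_subset: "next_depths D k \<subseteq> {1..V}"
  using C by (auto simp: next_depths_def moved_depths_def Let_def)

lemma lpr_depths_subset: "lpr_depths d t \<subseteq> {1..V}"
  using next_depths_subset by (cases t) auto

lemma card_moved_depths:
  assumes "k \<in> {1..V}" "D \<subseteq> {1..V}"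
  shows "card (moved_depths D k) = card D"
proof -
  let ?r = "move_to_top (\<lambda>j. j) k"
  have r: "inj_on ?r {1..V}" "?r ` {1..V} = {1..V}"
    using bij_betw_move_to_top[OF assms(1)] by (simp_all add: bij_betw_def)
  have "inj_on ?r (moved_depths D k)"
    by (rule inj_on_subset[OF r(1)]) (auto simp: moved_depths_def)
  moreover have "?r ` moved_depths D k = D"
  proof
    show "D \<subseteq> ?r ` moved_depths D k"
    proof
      fix j assume j: "j \<in> D"
      then obtain i where "i \<in> {1..V}" "?r i = j" using r(2) assms(2) by (metis imageE subsetD)
      with j show "j \<in> ?r ` moved_depths D k" by (auto simp: moved_depths_def)
    qed
  qed (auto simp: moved_depths_def)
  ultimately show ?thesis by (metis card_image)
qed

text \<open>Before the first eviction the buffered items are those accessed so far, and they form an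
  initial segment of the stack.\<close>

lemma next_depths_filling:
  assumes "k \<in> {1..V}" "n < C"
  shows "next_depths {1..n} k = (if k \<le> n then {1..n} else {1..Suc n})"
proof (cases "k \<le> n")
  case True
  then have "moved_depths {1..n} k = {1..n}"
    using assms C by (auto simp: moved_depths_def move_to_top_def split: if_splits)
  then show ?thesis using True assms by (simp add: next_depths_def)
next
  case False
  then have "moved_depths {1..n} k = {2..Suc n}"
    using assms C by (auto simp: moved_depths_def move_to_top_def split: if_splits)
  moreover have "insert 1 {2..Suc n} = {1..Suc n}" by auto
  ultimately show ?thesis using False assms by (simp add: next_depths_def)
qed

definition full :: "nat set \<Rightarrow> bool" where
  "full D \<longleftrightarrow> card D = C \<and> {1..K} \<subseteq> D \<and> D \<subseteq> {1..L}"

text \<open>A miss pushes the items at depths \<open>K\<close> and \<open>L\<close> across the ends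
  of the edge, and the victim is one that lands at \<open>Suc L\<close> or \<open>Suc K\<close>.
  Insertion at 1 and eviction leave \<open>K + 2..L\<close> alone, so there the set just follows the
  shift of the stack.\<close>

lemma next_depths_full:
  assumes k: "k \<in> {1..V}" and D: "full D"
  shows "full (next_depths D k)"
    and "\<And>i. i \<in> {K + 2..L} \<Longrightarrow> i \<in> next_depths D k \<longleftrightarrow> (if k < i then i \<in> D else i - 1 \<in> D)"
proof -
  let ?D' = "moved_depths D k" and ?N = "next_depths D k"
  have DV: "D \<subseteq> {1..V}" using D L by (auto simp: full_def)
  have card': "card ?D' = C" using card_moved_depths[OF k DV] D by (simp add: full_def)
  have fin': "finite ?D'" by (simp add: moved_depths_def)
  have KV: "Suc K \<le> V" "1 \<le> K" "Suc K \<le> L" using K C L by auto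
  have "full ?N \<and> (\<forall>i\<in>{K + 2..L}. i \<in> ?N \<longleftrightarrow> (if k < i then i \<in> D else i - 1 \<in> D))"
  proof (cases "k \<in> D")
    case True
    then have N: "?N = ?D'" by (simp add: next_depths_def)
    have "k \<le> L" using True D by (auto simp: full_def)
    have "{1..K} \<subseteq> ?D'" "?D' \<subseteq> {1..L}"
      using True D KV \<open>k \<le> L\<close> by (force simp: moved_depths_def move_to_top_def full_def split: if_splits)+
    moreover have "i \<in> ?D' \<longleftrightarrow> (if k < i then i \<in> D else i - 1 \<in> D)" if "i \<in> {K + 2..L}" for i
      using that L by (auto simp: moved_depths_def move_to_top_def)
    ultimately show ?thesis using card' by (simp add: N full_def)
  next
    case False
    then have kK: "K < k" using D k by (force simp: full_def)
    have one: "1 \<notin> ?D'" using False by (simp add: moved_depths_def move_to_top_def)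
    have lower: "{2..Suc K} \<subseteq> ?D'"
      using kK D KV by (force simp: moved_depths_def move_to_top_def full_def)
    have upper: "?D' \<subseteq> {2..min V (Suc L)}"
    proof
      fix i assume i: "i \<in> ?D'"
      then have "i \<noteq> 1" using one by auto
      with i D show "i \<in> {2..min V (Suc L)}"
        by (force simp: moved_depths_def move_to_top_def full_def split: if_splits)
    qed
    define e where "e = (if Suc L \<in> ?D' then Suc L else Suc K)"
    have N: "?N = insert 1 (?D' - {e})"
      using False D evicted_depth[OF lower upper]
      by (simp add: next_depths_def e_def full_def)
    have e: "e \<in> ?D'" "K < e" using lower KV by (auto simp: e_def)
    have "card ?N = C" using N one e card' fin' C by simp
    moreover have "{1..K} \<subseteq> ?N"
    proof
      fix i assume "i \<in> {1..K}"
      then show "i \<in> ?N" using N lower e by (cases "i = 1") auto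
    qed
    moreover have "?N \<subseteq> {1..L}"
    proof
      fix i assume i: "i \<in> ?N"
      then have "i = 1 \<or> i \<in> ?D' \<and> i \<noteq> e" unfolding N by blast
      then show "i \<in> {1..L}"
      proof
        assume i': "i \<in> ?D' \<and> i \<noteq> e"
        then have "i \<noteq> Suc L" by (metis e_def)
        with i' upper show ?thesis by force
      qed (use KV in simp)
    qed
    moreover have "i \<in> ?N \<longleftrightarrow> (if k < i then i \<in> D else i - 1 \<in> D)" if "i \<in> {K + 2..L}" for i
    proof -
      have "i \<in> ?N \<longleftrightarrow> i \<in> ?D'" using that N by (auto simp: e_def)
      then show ?thesis using that L by (auto simp: moved_depths_def move_to_top_def)
    qed
    ultimately show ?thesis by (simp add: full_def)
  qed
  then show "full ?N" "\<And>i. i \<in> {K + 2..L} \<Longrightarrow> i \<in> ?N \<longleftrightarrow> (if k < i then i \<in> D else i - 1 \<in> D)"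
    by blast+
qed

lemma full_not_less: "full D \<Longrightarrow> \<not> card D < C"
  by (simp add: full_def)

lemma lpr_depths_cases:
  assumes d: "\<And>i. d i \<in> {1..V}"
  shows "(\<exists>n<C. lpr_depths d t = {1..n}) \<or> full (lpr_depths d t)"
proof (induction t)
  case 0
  have "lpr_depths d 0 = {1..0}" by simp
  then show ?case using C by (metis less_le_trans zero_less_one)
next
  case (Suc t)
  then show ?case
  proof (elim disjE exE conjE)
    fix n assume n: "n < C" "lpr_depths d t = {1..n}"
    have step: "lpr_depths d (Suc t) = (if d t \<le> n then {1..n} else {1..Suc n})"
      using next_depths_filling[OF d n(1)] n(2) by simp
    have "full {1..C}" using K C_less_L by (auto simp: full_def)
    then show ?thesis using n(1) step by (cases "Suc n = C") auto
  next
    assume "full (lpr_depths d t)"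
    then show ?thesis using next_depths_full(1)[OF d] by simp
  qed
qed

text \<open>The clause on the image is carried through the induction to ensure that every buffered
  item has a depth; the capacity can then be tested on the set of depths.\<close>

lemma lpr_depths_correct:
  assumes inj: "inj_on \<Lambda> {1..V}" and d: "\<And>i. d i \<in> {1..V}"
  shows "lpr_depths d t = {i \<in> {1..V}. lru_stack \<Lambda> d t i \<in> buffer C \<Lambda> (lpr V s \<Lambda>) d t}
    \<and> buffer C \<Lambda> (lpr V s \<Lambda>) d t \<subseteq> \<Lambda> ` {1..V}"
proof (induction t)
  case 0
  show ?case by simp
next
  case (Suc t)
  let ?R = "\<Lambda> ` {1..V}"
  define D where "D = lpr_depths d t"
  define B where "B = buffer C \<Lambda> (lpr V s \<Lambda>) d t"
  define S where "S = lru_stack \<Lambda> d t"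
  define S' where "S' = lru_stack \<Lambda> d (Suc t)"
  define k where "k = d t"
  define D' where "D' = moved_depths D k"
  have bij: "bij_betw \<Lambda> {1..V} ?R" using inj by (simp add: bij_betw_def)
  have S: "bij_betw S {1..V} ?R" unfolding S_def by (rule bij_betw_lru_stack[OF bij d])
  have S': "bij_betw S' {1..V} ?R" unfolding S'_def by (rule bij_betw_lru_stack[OF bij d])
  have k: "k \<in> {1..V}" using d by (simp add: k_def)
  have D: "D = {i \<in> {1..V}. S i \<in> B}" and BR: "B \<subseteq> ?R"
    using Suc by (simp_all add: D_def B_def S_def)
  have S'S: "S' i = S (move_to_top (\<lambda>j. j) k i)" for i
    by (simp add: S'_def S_def k_def move_to_top_def)
  have m: "move_to_top (\<lambda>j. j) k i \<in> {1..V}" if "i \<in> {1..V}" for i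
    using that k by (auto simp: move_to_top_def)
  have D': "D' = {i \<in> {1..V}. S' i \<in> B}"
    unfolding D'_def moved_depths_def D using m by (auto simp: S'S)
  have S'1: "S' 1 = S k" by (simp add: S'S move_to_top_def)
  have x: "accessed \<Lambda> d t = S' 1" by (simp add: S'1[unfolded One_nat_def] accessed_def S_def k_def)
  have xR: "S' 1 \<in> ?R" using S' C by (force simp: bij_betw_def)
  have hit: "S' 1 \<in> B \<longleftrightarrow> k \<in> D" using k by (simp add: S'1[unfolded One_nat_def] D)
  have cardB: "card B = card D"
  proof -
    have S2: "inj_on S {1..V}" "S ` {1..V} = ?R" using S by (simp_all add: bij_betw_def)
    have "inj_on S D" by (rule inj_on_subset[OF S2(1)]) (auto simp: D)
    moreover have "S ` D = B"
    proof
      show "B \<subseteq> S ` D"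
      proof
        fix y assume y: "y \<in> B"
        then obtain i where "i \<in> {1..V}" "y = S i" using S2(2) BR by (metis imageE subsetD)
        with y show "y \<in> S ` D" by (auto simp: D)
      qed
    qed (auto simp: D)
    ultimately show ?thesis by (metis card_image)
  qed
  have B': "buffer C \<Lambda> (lpr V s \<Lambda>) d (Suc t) =
      (if k \<in> D then B else if card D < C then insert (S' 1) B
        else insert (S' 1) (B - {lpr V s \<Lambda> d t B}))"
    by (simp add: Let_def x hit[unfolded One_nat_def] cardB flip: B_def)
  have eq1: "S' i = S' 1 \<longleftrightarrow> i = 1" if "i \<in> {1..V}" for i
    using inj_on_eq_iff[OF bij_betw_imp_inj_on[OF S'] that, of 1] C by simp
  have "next_depths D k = {i \<in> {1..V}. S' i \<in> buffer C \<Lambda> (lpr V s \<Lambda>) d (Suc t)}"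
  proof (cases "k \<in> D \<or> card D < C")
    case True
    then show ?thesis
      using C eq1 unfolding B' next_depths_def Let_def D'_def[symmetric] by (auto simp: D')
  next
    case False
    define e where "e = (LEAST i. i \<in> D' \<and> (\<forall>j\<in>D'. profit_rate V s i \<le> profit_rate V s j))"
    have "card D' = card D" unfolding D'_def by (rule card_moved_depths[OF k]) (use D in auto)
    then have "D' \<noteq> {}" using False C by auto
    then have e: "e \<in> D'" unfolding e_def by (intro least_minimizer_in) (simp add: D')
    \<comment> \<open>Depth 1 holds the missing item, so the range \<open>{2..V}\<close> in
      \<open>lpr\<close> loses no buffered depth.\<close>
    have "1 \<notin> D'" using False hit by (simp add: D')
    then have "{i \<in> {2..V}. S' i \<in> B} = D'"
      unfolding D' by (auto simp: Suc_le_eq order_le_less numeral_2_eq_2)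
    then have lpr: "lpr V s \<Lambda> d t B = S' e"
      unfolding lpr_def Let_def S'_def[symmetric] e_def by simp
    have eqe: "S' i = S' e \<longleftrightarrow> i = e" if "i \<in> {1..V}" for i
      using inj_on_eq_iff[OF bij_betw_imp_inj_on[OF S'] that, of e] e by (simp add: D')
    have "next_depths D k = insert 1 (D' - {e})"
      using False by (simp add: next_depths_def e_def D'_def[symmetric] Let_def)
    also have "\<dots> = {i \<in> {1..V}. S' i \<in> insert (S' 1) (B - {S' e})}"
      using C eq1 eqe by (auto simp: D')
    finally show ?thesis using False unfolding B' by (simp add: lpr)
  qed
  moreover have "buffer C \<Lambda> (lpr V s \<Lambda>) d (Suc t) \<subseteq> ?R"
    using BR xR unfolding B' by auto
  ultimately show ?case by (simp add: S'_def D_def k_def del: buffer.simps lru_stack.simps)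
qed

lemma misses_lpr:
  assumes inj: "inj_on \<Lambda> {1..V}" and d: "\<And>i. d i \<in> {1..V}"
  shows "real (misses C \<Lambda> (lpr V s \<Lambda>) d n) = (\<Sum>t<n. of_bool (d t \<notin> lpr_depths d t))"
proof -
  have "accessed \<Lambda> d t \<notin> buffer C \<Lambda> (lpr V s \<Lambda>) d t \<longleftrightarrow> d t \<notin> lpr_depths d t" for t
    using lpr_depths_correct[OF inj d, where t = t] d[of t] by (simp add: accessed_def)
  then have "real (faults (accessed \<Lambda> d) (buffer C \<Lambda> (lpr V s \<Lambda>) d) n)
      = (\<Sum>t<n. of_bool (d t \<notin> lpr_depths d t))"
    by (induction n) (simp_all add: faults_Suc)
  then show ?thesis by (simp add: misses_eq_faults)
qed

end

section \<open>The miss rate of LPR\<close>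

lemma bigo_1_imp_average_tendsto:
  fixes f :: "nat \<Rightarrow> real"
  assumes "(\<lambda>n. f n - c * real n) \<in> O(\<lambda>_. 1)"
  shows "(\<lambda>n. f n / real n) \<longlonglongrightarrow> c"
proof -
  obtain B where B: "eventually (\<lambda>n. norm (f n - c * real n) \<le> B * norm (1::real)) sequentially"
    using assms by (auto elim: landau_o.bigE)
  have "(\<lambda>n. f n / real n - c) \<longlonglongrightarrow> 0"
  proof (rule tendsto_0_le[where K = 1])
    show "(\<lambda>n. B / real n) \<longlonglongrightarrow> 0" by (rule lim_const_over_n)
    show "eventually (\<lambda>n. norm (f n / real n - c) \<le> norm (B / real n) * 1) sequentially"
      using B eventually_gt_at_top[of 0]
    proof eventually_elim
      case (elim n)
      have "f n / real n - c = (f n - c * real n) / real n" using elim by (simp add: field_simps)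
      then have "norm (f n / real n - c) = norm (f n - c * real n) / real n" by simp
      also have "\<dots> \<le> B / real n" using elim by (intro divide_right_mono) auto
      also have "\<dots> \<le> norm (B / real n) * 1" by (simp add: divide_right_mono)
      finally show ?case .
    qed
  qed
  then show ?thesis by (rule LIM_zero_cancel)
qed

lemma bounded_imp_bigo_1:
  fixes f :: "'a \<Rightarrow> real"
  shows "(\<And>n. \<bar>f n\<bar> \<le> B) \<Longrightarrow> f \<in> O[F](\<lambda>_. 1)"
  by (rule landau_o.bigI[of "max 1 B"]) (auto intro!: always_eventually simp: le_max_iff_disj)

text \<open>Bounded partial sums make the time averages tend to 0. Stationarity is expressed in this
  averaged form, which avoids convergence of the distribution itself.\<close>

definition sum_bounded :: "(nat \<Rightarrow> real) \<Rightarrow> bool" where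
  "sum_bounded a \<longleftrightarrow> (\<lambda>\<tau>. \<Sum>t<\<tau>. a t) \<in> O(\<lambda>_. 1)"

lemma sum_bounded_add: "sum_bounded a \<Longrightarrow> sum_bounded b \<Longrightarrow> sum_bounded (\<lambda>t. a t + b t)"
  unfolding sum_bounded_def by (simp add: sum.distrib sum_in_bigo)

lemma sum_bounded_diff: "sum_bounded a \<Longrightarrow> sum_bounded b \<Longrightarrow> sum_bounded (\<lambda>t. a t - b t)"
  unfolding sum_bounded_def by (simp add: sum_subtractf sum_in_bigo)

lemma sum_bounded_cmult: "sum_bounded a \<Longrightarrow> sum_bounded (\<lambda>t. c * a t)"
  unfolding sum_bounded_def by (cases "c = 0") (simp_all flip: sum_distrib_left)

lemma sum_bounded_sum:
  "(\<And>i. i \<in> I \<Longrightarrow> sum_bounded (a i)) \<Longrightarrow> sum_bounded (\<lambda>t. \<Sum>i\<in>I. a i t)"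
  unfolding sum_bounded_def by (subst sum.swap) (rule big_sum_in_bigo)

section \<open>Expectations over the buffered depths\<close>

context lpr_model
begin

definition depths_expectation :: "(nat set \<Rightarrow> real) \<Rightarrow> nat \<Rightarrow> real" where
  "depths_expectation F t = (\<integral>d. F (lpr_depths d t) \<partial>depth_space s)"

definition not_full_prob :: "nat \<Rightarrow> real" where
  "not_full_prob = depths_expectation (\<lambda>D. of_bool (card D < C))"

lemma abs_le_sum_Pow:
  fixes F :: "nat set \<Rightarrow> real"
  shows "D \<subseteq> {1..V} \<Longrightarrow> \<bar>F D\<bar> \<le> (\<Sum>A\<in>Pow {1..V}. \<bar>F A\<bar>)"
  by (rule member_le_sum[of D "Pow {1..V}" "\<lambda>A. \<bar>F A\<bar>"]) auto

lemma lpr_depths_prefix: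
  "(\<And>i. i < t \<Longrightarrow> d i = d' i) \<Longrightarrow> lpr_depths d t = lpr_depths d' t"
  by (induction t) auto

lemma prefix_determined_lpr_depths: "prefix_determined t (\<lambda>d. F (lpr_depths d t))"
proof (rule prefix_determinedI)
  fix d d' :: "nat \<Rightarrow> nat" assume "\<And>i. i < t \<Longrightarrow> d i = d' i"
  then have "lpr_depths d t = lpr_depths d' t" by (rule lpr_depths_prefix)
  then show "F (lpr_depths d t) = F (lpr_depths d' t)" by simp
qed

lemma integrable_lpr_depths:
  fixes F :: "nat set \<Rightarrow> real"
  shows "integrable (depth_space s) (\<lambda>d. F (lpr_depths d t))"
  by (rule prefix_integrable[OF prefix_determined_lpr_depths abs_le_sum_Pow[OF lpr_depths_subset]])

lemma depths_expectation_diff: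
  "depths_expectation F t - depths_expectation G t = depths_expectation (\<lambda>D. F D - G D) t"
  using integrable_lpr_depths by (simp add: depths_expectation_def)

lemma depths_expectation_add:
  "depths_expectation F t + depths_expectation G t = depths_expectation (\<lambda>D. F D + G D) t"
  using integrable_lpr_depths by (simp add: depths_expectation_def)

lemma depths_expectation_cmult:
  "c * depths_expectation F t = depths_expectation (\<lambda>D. c * F D) t"
  by (simp add: depths_expectation_def)

lemma depths_expectation_sum:
  "(\<Sum>i\<in>I. depths_expectation (F i) t) = depths_expectation (\<lambda>D. \<Sum>i\<in>I. F i D) t"
  unfolding depths_expectation_def
  by (rule Bochner_Integration.integral_sum[symmetric]) (rule integrable_lpr_depths)

lemma depths_expectation_const: "depths_expectation (\<lambda>_. c) t = c"
  using prob_space.prob_space[OF prob_space_depth_space] by (simp add: depths_expectation_def)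

lemma depths_expectation_mono:
  assumes "\<And>D. (\<exists>n<C. D = {1..n}) \<or> full D \<Longrightarrow> F D \<le> G D"
  shows "depths_expectation F t \<le> depths_expectation G t"
  unfolding depths_expectation_def
proof (rule integral_mono_AE)
  from AE_depths[OF supp] show "AE d in depth_space s. F (lpr_depths d t) \<le> G (lpr_depths d t)"
  proof eventually_elim
    case (elim d)
    then show ?case by (intro assms lpr_depths_cases) blast
  qed
qed (rule integrable_lpr_depths)+

lemma integral_depth_lpr:
  "(\<integral>d. H (lpr_depths d t) (d t) \<partial>depth_space s)
    = depths_expectation (\<lambda>D. \<Sum>k=1..V. pmf s k * H D k) t"
proof -
  \<comment> \<open>Cut off outside \<open>{1..V}\<close>, where depths almost surely never lie, so
    that the single bound \<open>?B\<close> covers every \<open>k\<close>.\<close>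
  let ?H = "\<lambda>d k. if k \<in> {1..V} then H (lpr_depths d t) k else 0"
  let ?B = "\<Sum>k=1..V. \<Sum>A\<in>Pow {1..V}. \<bar>H A k\<bar>"
  have bd: "\<bar>?H d k\<bar> \<le> ?B" for d k
  proof (cases "k \<in> {1..V}")
    case True
    then have "\<bar>?H d k\<bar> \<le> (\<Sum>A\<in>Pow {1..V}. \<bar>H A k\<bar>)"
      using abs_le_sum_Pow[OF lpr_depths_subset, of "\<lambda>D. H D k"] by simp
    also have "\<dots> \<le> ?B"
      using True by (intro member_le_sum[where f = "\<lambda>k. \<Sum>A\<in>Pow {1..V}. \<bar>H A k\<bar>"])
        (auto intro: sum_nonneg)
    finally show ?thesis .
  qed (auto intro!: sum_nonneg)
  have pd: "prefix_determined t (\<lambda>d. ?H d k)" for k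
    by (rule prefix_determined_lpr_depths[of t "\<lambda>D. if k \<in> {1..V} then H D k else 0"])
  have "(\<integral>d. ?H d (d t) \<partial>depth_space s)
      = (\<integral>d. (\<Sum>k=1..V. pmf s k * ?H d k) \<partial>depth_space s)"
    by (rule integral_independent_depth[where H = ?H, OF supp pd bd])
  moreover have "(\<integral>d. ?H d (d t) \<partial>depth_space s) = (\<integral>d. H (lpr_depths d t) (d t) \<partial>depth_space s)"
  proof (rule integral_cong_AE)
    have "prefix_determined (Suc t) (\<lambda>d. H (lpr_depths d t) (d t))"
      "prefix_determined (Suc t) (\<lambda>d. ?H d (d t))"
    proof (rule_tac [!] prefix_determinedI)
      fix d d' :: "nat \<Rightarrow> nat" assume *: "\<And>i. i < Suc t \<Longrightarrow> d i = d' i"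
      have "lpr_depths d t = lpr_depths d' t" by (rule lpr_depths_prefix) (simp add: *)
      then show "H (lpr_depths d t) (d t) = H (lpr_depths d' t) (d' t)"
        "?H d (d t) = ?H d' (d' t)" using *[of t] by simp_all
    qed
    then show "(\<lambda>d. H (lpr_depths d t) (d t)) \<in> borel_measurable (depth_space s)"
      "(\<lambda>d. ?H d (d t)) \<in> borel_measurable (depth_space s)" by (simp_all only: prefix_measurable)
    from AE_depths[OF supp] show "AE d in depth_space s. ?H d (d t) = H (lpr_depths d t) (d t)"
    proof eventually_elim
      case (elim d)
      from elim[rule_format, of t] show ?case by simp
    qed
  qed
  ultimately show ?thesis by (simp add: depths_expectation_def)
qed

lemma depths_expectation_Suc:
  "depths_expectation F (Suc t) = depths_expectation (\<lambda>D. \<Sum>k=1..V. pmf s k * F (next_depths D k)) t"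
  unfolding integral_depth_lpr[symmetric] by (simp add: depths_expectation_def)

text \<open>The expected buffer size never exceeds \<open>C\<close>, yet each step begun with a free
  slot raises it by at least \<open>tail_prob V s (C - 1)\<close>. So the expected time before the
  buffer fills is finite.\<close>

lemma sum_not_full: "(\<Sum>t<\<tau>. not_full_prob t) \<le> real C / tail_prob V s (C - 1)"
proof -
  let ?q = "tail_prob V s (C - 1)"
  let ?E = "depths_expectation (\<lambda>D. real (card D))"
  have q: "?q > 0" using C by (intro tail_prob_pos) auto
  have step: "?E t + ?q * not_full_prob t \<le> ?E (Suc t)" for t
    unfolding not_full_prob_def depths_expectation_cmult depths_expectation_add depths_expectation_Suc
  proof (rule depths_expectation_mono, elim disjE exE conjE)
    fix D n assume n: "n < C" "D = {1..n}"
    have "(\<Sum>k=1..V. pmf s k * real (card (next_depths D k)))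
        = (\<Sum>k=1..V. pmf s k * real n + (if n < k then pmf s k else 0))"
      by (rule sum.cong) (use next_depths_filling n in \<open>auto simp: algebra_simps\<close>)
    also have "\<dots> = real n * (\<Sum>k=1..V. pmf s k) + (\<Sum>k=1..V. if n < k then pmf s k else 0)"
      by (simp add: sum.distrib sum_distrib_left mult.commute)
    also have "(\<Sum>k=1..V. if n < k then pmf s k else 0) = tail_prob V s n"
      unfolding tail_prob_def by (subst sum.inter_filter[symmetric]) (auto intro!: sum.cong)
    finally have "(\<Sum>k=1..V. pmf s k * real (card (next_depths D k))) = real n + tail_prob V s n"
      using sum_pmf_support[OF supp] by simp
    moreover have "?q \<le> tail_prob V s n"
      unfolding tail_prob_def using n by (intro sum_mono2) auto
    ultimately have "real n + ?q \<le> (\<Sum>k=1..V. pmf s k * real (card (next_depths D k)))"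
      by simp
    then show "real (card D) + ?q * of_bool (card D < C)
        \<le> (\<Sum>k=1..V. pmf s k * real (card (next_depths D k)))"
      using n by simp
  next
    fix D assume D: "full D"
    have "(\<Sum>k=1..V. pmf s k * real (card (next_depths D k))) = (\<Sum>k=1..V. pmf s k * real C)"
      by (rule sum.cong) (use next_depths_full(1)[OF _ D] in \<open>auto simp: full_def\<close>)
    also have "\<dots> = real C" using sum_pmf_support[OF supp] by (simp flip: sum_distrib_right)
    finally show "real (card D) + ?q * of_bool (card D < C)
        \<le> (\<Sum>k=1..V. pmf s k * real (card (next_depths D k)))"
      using D by (simp add: full_def)
  qed
  have "?q * (\<Sum>t<\<tau>. not_full_prob t) \<le> ?E \<tau>"
  proof (induction \<tau>)
    case 0
    show ?case by (simp add: depths_expectation_def)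
  next
    case (Suc \<tau>)
    then show ?case using step[of \<tau>] by (simp add: algebra_simps)
  qed
  also have "?E \<tau> \<le> depths_expectation (\<lambda>_. real C) \<tau>"
    by (rule depths_expectation_mono) (auto simp: full_def)
  also have "\<dots> = real C" by (rule depths_expectation_const)
  finally show ?thesis using q by (simp add: field_simps)
qed

text \<open>The expectations differ by at most a constant times \<open>not_full_prob\<close>, which
  has bounded sums. All long-run computations may thus assume a full buffer.\<close>

lemma sum_bounded_if_eq_on_full:
  assumes "\<And>D. full D \<Longrightarrow> F D = G D"
  shows "sum_bounded (\<lambda>t. depths_expectation F t - depths_expectation G t)"
proof -
  let ?c = "\<Sum>A\<in>Pow {1..V}. \<bar>F A - G A\<bar>"
  have c: "0 \<le> ?c" by (intro sum_nonneg) simp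
  have le: "\<bar>depths_expectation F t - depths_expectation G t\<bar> \<le> ?c * not_full_prob t" for t
  proof -
    have *: "\<bar>F D - G D\<bar> \<le> ?c * of_bool (card D < C)" if "(\<exists>n<C. D = {1..n}) \<or> full D" for D
    proof (cases "full D")
      case True
      then show ?thesis using assms by (simp add: full_not_less)
    next
      case False
      with that obtain n where n: "n < C" "D = {1..n}" by blast
      then have "D \<subseteq> {1..V}" using C by auto
      from abs_le_sum_Pow[OF this, of "\<lambda>D. F D - G D"] n show ?thesis by simp
    qed
    have "depths_expectation (\<lambda>D. F D - G D) t \<le> depths_expectation (\<lambda>D. ?c * of_bool (card D < C)) t"
      by (rule depths_expectation_mono) (use * in force)
    moreover have "depths_expectation (\<lambda>D. G D - F D) t \<le> depths_expectation (\<lambda>D. ?c * of_bool (card D < C)) t"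
      by (rule depths_expectation_mono) (use * in force)
    ultimately show ?thesis
      by (simp add: not_full_prob_def depths_expectation_cmult abs_le_iff
          flip: depths_expectation_diff)
  qed
  have "\<bar>\<Sum>t<\<tau>. depths_expectation F t - depths_expectation G t\<bar> \<le> ?c * (real C / tail_prob V s (C - 1))" for \<tau>
  proof -
    have "\<bar>\<Sum>t<\<tau>. depths_expectation F t - depths_expectation G t\<bar>
        \<le> (\<Sum>t<\<tau>. \<bar>depths_expectation F t - depths_expectation G t\<bar>)" by (rule sum_abs)
    also have "\<dots> \<le> (\<Sum>t<\<tau>. ?c * not_full_prob t)" by (rule sum_mono) (rule le)
    also have "\<dots> = ?c * (\<Sum>t<\<tau>. not_full_prob t)" by (simp add: sum_distrib_left)
    also have "\<dots> \<le> ?c * (real C / tail_prob V s (C - 1))" by (intro mult_left_mono sum_not_full c)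
    finally show ?thesis .
  qed
  then show ?thesis unfolding sum_bounded_def by (rule bounded_imp_bigo_1)
qed

section \<open>Long-run occupation of the individual depths\<close>

definition in_buffer_prob :: "nat \<Rightarrow> nat \<Rightarrow> real" where
  "in_buffer_prob i = depths_expectation (\<lambda>D. of_bool (i \<in> D))"

lemma in_buffer_prob_range: "0 \<le> in_buffer_prob i t" "in_buffer_prob i t \<le> 1"
  using depths_expectation_mono[of "\<lambda>_. 0" "\<lambda>D. of_bool (i \<in> D)" t]
    depths_expectation_mono[of "\<lambda>D. of_bool (i \<in> D)" "\<lambda>_. 1" t]
  by (simp_all add: in_buffer_prob_def depths_expectation_const)

lemma in_buffer_prob_top:
  assumes "i \<in> {1..K}"
  shows "sum_bounded (\<lambda>t. in_buffer_prob i t - 1)"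
proof -
  have "of_bool (i \<in> D) = (1::real)" if "full D" for D
    using that assms by (auto simp: full_def)
  from sum_bounded_if_eq_on_full[OF this] show ?thesis
    by (simp add: in_buffer_prob_def depths_expectation_const)
qed

lemma in_buffer_prob_bottom:
  assumes "i > L"
  shows "sum_bounded (in_buffer_prob i)"
proof -
  have "of_bool (i \<in> D) = (0::real)" if "full D" for D
    using that assms by (auto simp: full_def)
  from sum_bounded_if_eq_on_full[OF this] show ?thesis
    by (simp add: in_buffer_prob_def depths_expectation_const)
qed

lemma in_buffer_prob_total: "sum_bounded (\<lambda>t. (\<Sum>i=Suc K..L. in_buffer_prob i t) - (real C - real K))"
proof -
  have "(\<Sum>i=Suc K..L. of_bool (i \<in> D)) = real C - real K" if D: "full D" for D
  proof -
    have D': "{1..K} \<subseteq> D" "D \<subseteq> {1..L}" "card D = C" using D by (auto simp: full_def)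
    have "(\<Sum>i=Suc K..L. of_bool (i \<in> D)) = real (card ({Suc K..L} \<inter> D))"
      by (simp add: of_bool_def sum.If_cases)
    also have "{Suc K..L} \<inter> D = D - {1..K}" using D' by auto
    also have "card (D - {1..K}) = C - K" using D' card_Diff_subset[of "{1..K}" D] by simp
    finally show ?thesis using K by simp
  qed
  from sum_bounded_if_eq_on_full[OF this] show ?thesis
    by (simp add: in_buffer_prob_def depths_expectation_sum depths_expectation_const)
qed

text \<open>
  Stationarity forces equal occupation of adjacent depths inside the edge: an access below depth
  \<open>i - 1\<close> moves the bit at \<open>i - 1\<close> to \<open>i\<close>.
\<close>

lemma in_buffer_prob_adjacent:
  assumes i: "i \<in> {K + 2..L}"
  shows "sum_bounded (\<lambda>t. in_buffer_prob (i - 1) t - in_buffer_prob i t)"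
proof -
  let ?q = "tail_prob V s (i - 1)"
  let ?F = "\<lambda>D. \<Sum>k=1..V. pmf s k * of_bool (i \<in> next_depths D k)"
  let ?G = "\<lambda>D. of_bool (i \<in> D) + ?q * (of_bool (i - 1 \<in> D) - of_bool (i \<in> D))"
  have q: "?q > 0" using i L by (intro tail_prob_pos) auto
  have "?F D = ?G D" if D: "full D" for D
  proof -
    have "?F D = (\<Sum>k=1..V. of_bool (i \<in> D) * pmf s k
        + (of_bool (i - 1 \<in> D) - of_bool (i \<in> D)) * (if i - 1 < k then pmf s k else 0))"
      by (rule sum.cong) (use next_depths_full(2)[OF _ D i] i in \<open>auto simp: algebra_simps\<close>)
    also have "\<dots> = of_bool (i \<in> D) * (\<Sum>k=1..V. pmf s k)
        + (of_bool (i - 1 \<in> D) - of_bool (i \<in> D)) * (\<Sum>k=1..V. if i - 1 < k then pmf s k else 0)"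
      by (simp only: sum.distrib sum_distrib_left)
    also have "(\<Sum>k=1..V. if i - 1 < k then pmf s k else 0) = ?q"
      unfolding tail_prob_def by (subst sum.inter_filter[symmetric]) (auto intro!: sum.cong)
    finally show ?thesis using sum_pmf_support[OF supp] by simp
  qed
  then have "sum_bounded (\<lambda>t. depths_expectation ?F t - depths_expectation ?G t)"
    by (rule sum_bounded_if_eq_on_full)
  also have "(\<lambda>t. depths_expectation ?F t - depths_expectation ?G t)
      = (\<lambda>t. (in_buffer_prob i (Suc t) - in_buffer_prob i t)
          - ?q * (in_buffer_prob (i - 1) t - in_buffer_prob i t))"
    unfolding in_buffer_prob_def depths_expectation_Suc
    by (simp add: depths_expectation_cmult depths_expectation_diff algebra_simps)
  finally have "sum_bounded \<dots>" .
  \<comment> \<open>The change in one step telescopes. Subtracting leaves \<open>?q\<close> times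
    the difference of adjacent depths, and \<open>?q\<close> is positive.\<close>
  moreover have "sum_bounded (\<lambda>t. in_buffer_prob i (Suc t) - in_buffer_prob i t)"
    unfolding sum_bounded_def sum_lessThan_telescope
  proof (rule bounded_imp_bigo_1)
    show "\<bar>in_buffer_prob i n - in_buffer_prob i 0\<bar> \<le> 1" for n
      using in_buffer_prob_range[of i n] in_buffer_prob_range[of i 0] by simp
  qed
  ultimately have "sum_bounded (\<lambda>t. (in_buffer_prob i (Suc t) - in_buffer_prob i t)
      - ((in_buffer_prob i (Suc t) - in_buffer_prob i t)
          - ?q * (in_buffer_prob (i - 1) t - in_buffer_prob i t)))"
    by (rule sum_bounded_diff[rotated])
  then have "sum_bounded (\<lambda>t. ?q * (in_buffer_prob (i - 1) t - in_buffer_prob i t))" by simp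
  from sum_bounded_cmult[OF this, of "1 / ?q"] show ?thesis
    using q by (simp only: mult.assoc[symmetric]) simp
qed

text \<open>The edge has \<open>L - K\<close> depths of equal long-run occupation, and together they
  hold \<open>C - K\<close> items.\<close>

lemma in_buffer_prob_edge:
  assumes "i \<in> {Suc K..L}"
  shows "sum_bounded (\<lambda>t. in_buffer_prob i t - (real C - real K) / (real L - real K))"
proof -
  have diff: "sum_bounded (\<lambda>t. in_buffer_prob i t - in_buffer_prob L t)" if "i \<in> {Suc K..L}" for i
  proof -
    have "i \<le> L" using that by simp
    then show ?thesis
    proof (induction rule: inc_induct)
      case base
      show ?case by (simp add: sum_bounded_def)
    next
      case (step j)
      have "sum_bounded (\<lambda>t. in_buffer_prob j t - in_buffer_prob (Suc j) t)"
        using in_buffer_prob_adjacent[of "Suc j"] step that by simp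
      from sum_bounded_add[OF this step.IH] show ?case by simp
    qed
  qed
  let ?m = "(real C - real K) / (real L - real K)" and ?n = "real L - real K"
  have n: "?n > 0" using L by simp
  have "sum_bounded (\<lambda>t. (\<Sum>j=Suc K..L. in_buffer_prob j t - in_buffer_prob L t))"
    by (rule sum_bounded_sum) (rule diff)
  from sum_bounded_diff[OF in_buffer_prob_total this]
  have "sum_bounded (\<lambda>t. ?n * in_buffer_prob L t - (real C - real K))"
    using L by (simp add: sum_subtractf of_nat_diff algebra_simps)
  from sum_bounded_cmult[OF this, of "1 / ?n"]
  have "sum_bounded (\<lambda>t. in_buffer_prob L t - ?m)"
    using n by (simp add: diff_divide_distrib)
  from sum_bounded_add[OF diff[OF assms] this] show ?thesis by simp
qed

lemma buffer_lpr_prefix: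
  "(\<And>i. i < t \<Longrightarrow> d i = d' i) \<Longrightarrow> buffer C \<Lambda> (lpr V s \<Lambda>) d t = buffer C \<Lambda> (lpr V s \<Lambda>) d' t"
proof (induction t)
  case (Suc t)
  have "buffer C \<Lambda> (lpr V s \<Lambda>) d t = buffer C \<Lambda> (lpr V s \<Lambda>) d' t"
    by (rule Suc.IH) (simp add: Suc.prems)
  moreover have "lru_stack \<Lambda> d (Suc t) = lru_stack \<Lambda> d' (Suc t)"
    by (rule lru_stack_prefix) (rule Suc.prems)
  then have "lpr V s \<Lambda> d t B = lpr V s \<Lambda> d' t B" for B
    by (simp only: lpr_def)
  moreover have "accessed \<Lambda> d t = accessed \<Lambda> d' t"
    by (rule accessed_prefix) (simp add: Suc.prems)
  ultimately show ?case by (simp add: Let_def)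
qed simp

lemma prefix_determined_misses_lpr:
  "prefix_determined n (\<lambda>d. real (misses C \<Lambda> (lpr V s \<Lambda>) d n))"
proof (rule prefix_determinedI)
  fix d d' :: "nat \<Rightarrow> nat" assume *: "\<And>i. i < n \<Longrightarrow> d i = d' i"
  have "faults (accessed \<Lambda> d) (buffer C \<Lambda> (lpr V s \<Lambda>) d) n
      = faults (accessed \<Lambda> d') (buffer C \<Lambda> (lpr V s \<Lambda>) d') n"
  proof (rule faults_cong)
    fix t assume t: "t < n"
    have "accessed \<Lambda> d t = accessed \<Lambda> d' t"
      by (rule accessed_prefix) (use * t in simp)
    moreover have "buffer C \<Lambda> (lpr V s \<Lambda>) d t = buffer C \<Lambda> (lpr V s \<Lambda>) d' t"
      by (rule buffer_lpr_prefix) (use * t in simp)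
    ultimately show "(accessed \<Lambda> d t \<notin> buffer C \<Lambda> (lpr V s \<Lambda>) d t)
        = (accessed \<Lambda> d' t \<notin> buffer C \<Lambda> (lpr V s \<Lambda>) d' t)" by simp
  qed
  then show "real (misses C \<Lambda> (lpr V s \<Lambda>) d n) = real (misses C \<Lambda> (lpr V s \<Lambda>) d' n)"
    by (simp add: misses_eq_faults)
qed

lemma M_LPR_eq:
  assumes inj: "inj_on \<Lambda> {1..V}"
  shows "M_LPR V s C \<Lambda> = M"
proof -
  let ?m = "(real C - real K) / (real L - real K)"
  \<comment> \<open>\<open>c k\<close> is the long-run probability that depth \<open>k\<close> is
    buffered: certain above the edge, equally shared on it, zero below.\<close>
  define c where "c k = (if k \<le> K then 1 else if k \<le> L then ?m else 0)" for k
  let ?f = "\<lambda>\<tau>. \<integral>d. real (misses C \<Lambda> (lpr V s \<Lambda>) d \<tau>) \<partial>depth_space s"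
  have cP: "sum_bounded (\<lambda>t. in_buffer_prob k t - c k)" if "k \<in> {1..V}" for k
    using that in_buffer_prob_top[of k] in_buffer_prob_edge[of k] in_buffer_prob_bottom[of k]
    by (auto simp: c_def)
  have "(\<Sum>k=1..V. pmf s k * c k) = cum K + ?m * (cum L - cum K)"
  proof -
    have "(\<Sum>k=1..V. pmf s k * c k) = (\<Sum>k\<in>{1..K} \<union> {Suc K..L} \<union> {Suc L..V}. pmf s k * c k)"
      by (rule sum.cong) (use K L in auto)
    also have "\<dots> = (\<Sum>k=1..K. pmf s k * c k) + (\<Sum>k=Suc K..L. pmf s k * c k) + (\<Sum>k=Suc L..V. pmf s k * c k)"
      by (subst sum.union_disjoint; (subst sum.union_disjoint)?; insert L(1); auto)
    also have "(\<Sum>k=1..K. pmf s k * c k) = cum K" by (simp add: cum_def c_def)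
    also have "(\<Sum>k=Suc K..L. pmf s k * c k) = (\<Sum>k=Suc K..L. ?m * pmf s k)"
      by (rule sum.cong) (auto simp: c_def)
    also have "\<dots> = ?m * (cum L - cum K)"
      using L(1) by (simp only: cum_diff less_imp_le flip: sum_distrib_left)
    also have "(\<Sum>k=Suc L..V. pmf s k * c k) = 0"
    proof (rule sum.neutral, rule ballI)
      fix k assume "k \<in> {Suc L..V}"
      then have "c k = 0" using L(1) by (simp add: c_def)
      then show "pmf s k * c k = 0" by simp
    qed
    finally show ?thesis by simp
  qed
  \<comment> \<open>The edge equation for \<open>cum L\<close> cancels the denominator
    \<open>L - K\<close>.\<close>
  then have cM: "1 - (\<Sum>k=1..V. pmf s k * c k) = M"
    using L(1) by (simp add: M_def L(3) mult.commute)
  have miss: "(\<integral>d. of_bool (d t \<notin> lpr_depths d t) \<partial>depth_space s)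
      = 1 - (\<Sum>k=1..V. pmf s k * in_buffer_prob k t)" for t
  proof -
    have "(\<integral>d. of_bool (d t \<notin> lpr_depths d t) \<partial>depth_space s)
        = depths_expectation (\<lambda>D. \<Sum>k=1..V. pmf s k * of_bool (k \<notin> D)) t"
      by (rule integral_depth_lpr)
    also have "(\<lambda>D. \<Sum>k=1..V. pmf s k * of_bool (k \<notin> D)) = (\<lambda>D. 1 - (\<Sum>k=1..V. pmf s k * of_bool (k \<in> D)))"
      unfolding sum_pmf_support[OF supp, symmetric] sum_subtractf[symmetric]
      by (intro ext sum.cong) auto
    finally show ?thesis
      by (simp add: in_buffer_prob_def depths_expectation_cmult depths_expectation_sum
          depths_expectation_const flip: depths_expectation_diff)
  qed
  have f: "?f \<tau> = (\<Sum>t<\<tau>. 1 - (\<Sum>k=1..V. pmf s k * in_buffer_prob k t))" for \<tau>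
  proof -
    have pd: "prefix_determined (Suc t) (\<lambda>d. of_bool (d t \<notin> lpr_depths d t) :: real)" for t
    proof (rule prefix_determinedI)
      fix d d' :: "nat \<Rightarrow> nat" assume *: "\<And>i. i < Suc t \<Longrightarrow> d i = d' i"
      have "lpr_depths d t = lpr_depths d' t" by (rule lpr_depths_prefix) (simp add: *)
      then show "of_bool (d t \<notin> lpr_depths d t) = (of_bool (d' t \<notin> lpr_depths d' t) :: real)"
        using *[of t] by simp
    qed
    have int: "integrable (depth_space s) (\<lambda>d. of_bool (d t \<notin> lpr_depths d t) :: real)" for t
      by (rule prefix_integrable[OF pd, of _ 1]) simp
    have "?f \<tau> = (\<integral>d. (\<Sum>t<\<tau>. of_bool (d t \<notin> lpr_depths d t)) \<partial>depth_space s)"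
    proof -
      have "AE d in depth_space s. real (misses C \<Lambda> (lpr V s \<Lambda>) d \<tau>)
          = (\<Sum>t<\<tau>. of_bool (d t \<notin> lpr_depths d t))"
        using AE_depths[OF supp]
      proof eventually_elim
        case (elim d)
        then show ?case by (intro misses_lpr[OF inj]) blast
      qed
      moreover have "(\<lambda>d. \<Sum>t<\<tau>. of_bool (d t \<notin> lpr_depths d t) :: real) \<in> borel_measurable (depth_space s)"
        using int by (intro borel_measurable_sum borel_measurable_integrable)
      moreover have "(\<lambda>d. real (misses C \<Lambda> (lpr V s \<Lambda>) d \<tau>)) \<in> borel_measurable (depth_space s)"
        by (rule prefix_measurable[OF prefix_determined_misses_lpr])
      ultimately show ?thesis by (intro integral_cong_AE)
    qed
    also have "\<dots> = (\<Sum>t<\<tau>. 1 - (\<Sum>k=1..V. pmf s k * in_buffer_prob k t))"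
      unfolding miss[symmetric] by (rule Bochner_Integration.integral_sum) (rule int)
    finally show ?thesis .
  qed
  have "sum_bounded (\<lambda>t. \<Sum>k=1..V. pmf s k * (in_buffer_prob k t - c k))"
    using cP by (intro sum_bounded_sum sum_bounded_cmult)
  from sum_bounded_cmult[OF this, of "- 1"]
  have "sum_bounded (\<lambda>t. 1 - (\<Sum>k=1..V. pmf s k * in_buffer_prob k t) - M)"
    unfolding cM[symmetric] by (simp add: sum_subtractf right_diff_distrib algebra_simps)
  then have "(\<lambda>\<tau>. ?f \<tau> - M * real \<tau>) \<in> O(\<lambda>_. 1)"
    unfolding sum_bounded_def f by (simp add: sum_subtractf mult.commute)
  from bigo_1_imp_average_tendsto[OF this] show ?thesis
    unfolding M_LPR_def miss_rate_def by (rule limI)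
qed

end

section \<open>The competitive ratio\<close>

context lpr_model
begin

text \<open>With \<open>A\<close> as in the proof, \<open>R\<close> is twice the ratio of
  \<open>A - 1\<close> to \<open>A - C\<close>. Shrinking the initial gap \<open>A - 1\<close> by
  the factor \<open>R\<close> thus leaves half of \<open>A - C\<close>, and the expected count
  exceeds \<open>C\<close> by the other half.\<close>

lemma M_OPT_ge:
  assumes inj: "inj_on \<Lambda> {1..V}"
  defines "R \<equiv> 2 * (\<beta> * (real C - 1) + M) / M"
  shows "M / (2 * ln R + 4) \<le> M_OPT s C \<Lambda>"
proof -
  have M: "0 < M" using \<beta>_pos \<beta>_le_M by simp
  have bC: "0 \<le> \<beta> * (real C - 1)" using \<beta>_pos C by simp
  have b1: "\<beta> \<le> 1" using \<beta>_le_M M_le bC by linarith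
  have R2: "2 \<le> R" using M bC by (simp add: R_def field_simps)
  then have lnR: "0 \<le> ln R" by simp
  \<comment> \<open>\<open>A\<close> is the count at which the affine lower bound on
    \<open>tail_prob\<close> reaches zero.\<close>
  define A where "A = real C + M / \<beta>"
  have bA: "\<beta> * (A - 1) = \<beta> * (real C - 1) + M"
    using \<beta>_pos by (simp add: A_def algebra_simps)
  have "0 < \<beta> * (A - 1)" using bA bC M by simp
  then have A1: "0 < A - 1" using \<beta>_pos by (simp add: zero_less_mult_iff)
  \<comment> \<open>Chosen so that \<open>(1 - \<beta>) ^ T\<close> is at most \<open>1 / R\<close>,
    by comparison with the exponential. The window has length \<open>Suc T\<close> because the first
    access only sets the initial gap.\<close>
  define T where "T = nat \<lceil>ln R / \<beta>\<rceil>"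
  have T: "ln R / \<beta> \<le> real T" "real T \<le> ln R / \<beta> + 1"
    using lnR \<beta>_pos by (auto simp: T_def of_nat_ceiling)
  define e where "e = (\<integral>d. real (distinct_count d (Suc T)) \<partial>depth_space s)"
  have "A - e \<le> (A - 1) * (1 - \<beta>) ^ T"
    unfolding e_def
  proof (rule distinct_count_expectation[OF supp])
    show "\<beta> * (A - real k) \<le> tail_prob V s k" if "k \<in> {1..V}" for k
      using tail_prob_line[of k] that \<beta>_pos by (simp add: A_def algebra_simps)
  qed (use \<beta>_pos b1 in auto)
  also have "(A - 1) * (1 - \<beta>) ^ T \<le> (A - 1) * (1 / R)"
  proof (rule mult_left_mono)
    have "(1 - \<beta>) ^ T \<le> exp (- \<beta>) ^ T"
      using exp_ge_add_one_self[of "- \<beta>"] b1 by (intro power_mono) auto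
    also have "\<dots> = exp (- (\<beta> * real T))" by (simp add: exp_of_nat_mult[symmetric] mult.commute)
    also have "\<dots> \<le> exp (- ln R)" using T(1) \<beta>_pos by (simp add: field_simps)
    also have "\<dots> = 1 / R" using R2 by (simp add: exp_minus inverse_eq_divide)
    finally show "(1 - \<beta>) ^ T \<le> 1 / R" .
    show "0 \<le> A - 1" using A1 by simp
  qed
  also have "(A - 1) * (1 / R) = M / (2 * \<beta>)"
    unfolding R_def bA[symmetric] using M \<beta>_pos A1 by simp
  finally have "M / (2 * \<beta>) \<le> e - real C" by (simp add: A_def field_simps)
  then have "M / (2 * \<beta>) / real (Suc T) \<le> (e - real C) / real (Suc T)"
    by (rule divide_right_mono) simp
  also have "\<dots> \<le> M_OPT s C \<Lambda>"
    unfolding e_def by (rule miss_rate_opt_ge[OF C(1) inj supp]) simp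
  finally have "M / (2 * \<beta> * real (Suc T)) \<le> M_OPT s C \<Lambda>" by (simp only: divide_divide_eq_left)
  \<comment> \<open>Rounding \<open>T\<close> up and the extra access cost at most two units of
    time, hence the summand 4 as \<open>\<beta>\<close> is at most 1.\<close>
  moreover have "M / (2 * ln R + 4) \<le> M / (2 * \<beta> * real (Suc T))"
  proof (rule divide_left_mono)
    have "2 * \<beta> * real (Suc T) \<le> 2 * \<beta> * (ln R / \<beta> + 2)"
      using T(2) \<beta>_pos by (intro mult_left_mono) auto
    also have "\<dots> = 2 * ln R + 4 * \<beta>" using \<beta>_pos by (simp add: algebra_simps)
    finally show "2 * \<beta> * real (Suc T) \<le> 2 * ln R + 4" using b1 by linarith
  qed (use M \<beta>_pos lnR in \<open>auto intro!: mult_pos_pos add_nonneg_pos\<close>)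
  ultimately show ?thesis by linarith
qed

lemma chi_le:
  assumes inj: "inj_on \<Lambda> {1..V}" and X: "X = real C \<or> X = 1 / M"
  shows "chi V s C \<Lambda> \<le> 12 * ln (max 2 X)"
proof -
  define R where "R = 2 * (\<beta> * (real C - 1) + M) / M"
  define Y where "Y = max 2 X"
  have M: "0 < M" using \<beta>_pos \<beta>_le_M by simp
  have "\<beta> * (real C - 1) \<le> M * (real C - 1)" using \<beta>_le_M C by (intro mult_right_mono) auto
  then have "R \<le> 2 * real C" using M by (simp add: R_def field_simps)
  moreover have "R \<le> 2 * (1 / M)"
    using M_le M unfolding R_def by (simp add: divide_right_mono)
  ultimately have "R \<le> 2 * Y" using X by (auto simp: Y_def)
  moreover have R2: "2 \<le> R" using M \<beta>_pos C by (simp add: R_def field_simps)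
  ultimately have "ln R \<le> ln (2 * Y)" by simp
  also have "\<dots> = ln 2 + ln Y" by (simp add: Y_def ln_mult_pos)
  finally have "ln R \<le> ln 2 + ln Y" .
  moreover have "ln 2 \<le> ln Y" by (simp add: Y_def)
  moreover have "2 / 3 \<le> ln (2::real)" by (rule ln2_ge_two_thirds)
  \<comment> \<open>From \<open>ln 2 \<le> ln Y\<close> the left side is at most
    \<open>4 * ln Y + 4\<close>, and \<open>ln Y\<close> being at least 2/3 absorbs the constant
    4.\<close>
  ultimately have bound: "2 * ln R + 4 \<le> 12 * ln Y" by linarith
  have den: "0 < 2 * ln R + 4" using R2 ln_ge_zero[of R] by linarith
  have ge: "M / (2 * ln R + 4) \<le> M_OPT s C \<Lambda>"
    using M_OPT_ge[OF inj] by (simp add: R_def)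
  have "0 < M / (2 * ln R + 4)" using M den by simp
  with ge have "0 < M_OPT s C \<Lambda>" by linarith
  with ge have "M / M_OPT s C \<Lambda> \<le> 2 * ln R + 4"
    using den by (simp add: field_simps)
  with bound show ?thesis by (simp add: chi_def M_LPR_eq[OF inj] Y_def)
qed

end

text \<open>The \<open>max 2\<close> keeps the logarithms away from 0 when \<open>C = 1\<close> or
  the miss rate is close to 1.\<close>

theorem theorem4:
  "\<exists>c::real. \<forall>(V::nat) (s::nat pmf) (C::nat) (\<Lambda>0::nat \<Rightarrow> nat).
     2 \<le> V \<and> set_pmf s \<subseteq> {1..V} \<and> pmf s V > 0 \<and> 1 \<le> C \<and> inj_on \<Lambda>0 {1..V} \<longrightarrow>
     chi V s C \<Lambda>0 \<le> c * ln (max 2 (real C)) \<and>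
     (M_LPR V s C \<Lambda>0 \<ge> 1 / real C \<longrightarrow>
       chi V s C \<Lambda>0 \<le> c * ln (max 2 (1 / M_LPR V s C \<Lambda>0)))"
proof (intro exI[of _ 12] allI impI)
  fix V :: nat and s :: "nat pmf" and C :: nat and \<Lambda>0 :: "nat \<Rightarrow> nat"
  assume asm: "2 \<le> V \<and> set_pmf s \<subseteq> {1..V} \<and> pmf s V > 0 \<and> 1 \<le> C \<and> inj_on \<Lambda>0 {1..V}"
  then have inj: "inj_on \<Lambda>0 {1..V}" by blast
  have "chi V s C \<Lambda>0 \<le> 12 * ln (max 2 (real C)) \<and>
      chi V s C \<Lambda>0 \<le> 12 * ln (max 2 (1 / M_LPR V s C \<Lambda>0))"
  proof (cases "C < V")
    case True
    then interpret lpr_model V C s by unfold_locales (use asm in auto)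
    show ?thesis using chi_le[OF inj] by (simp add: M_LPR_eq[OF inj])
  next
    case False
    \<comment> \<open>When all items fit, \<open>chi\<close> is a quotient by 0 and has the value
      0.\<close>
    then have "M_OPT s C \<Lambda>0 = 0" using asm by (intro miss_rate_opt_eq_0) auto
    then show ?thesis by (simp add: chi_def)
  qed
  then show "chi V s C \<Lambda>0 \<le> 12 * ln (max 2 (real C)) \<and>
     (M_LPR V s C \<Lambda>0 \<ge> 1 / real C \<longrightarrow>
       chi V s C \<Lambda>0 \<le> 12 * ln (max 2 (1 / M_LPR V s C \<Lambda>0)))" by blast
qed

end
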